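(* Let $F$ be a holomorphic function in a neighborhood of the disc $\overline{\mathbb{D}}+1$ with $F(0)=0$. Then there is a function $K$ such that $F(\mathcal{C}_1)=(\mathcal{H}_K)_1$ and the following conditions hold: (a) $K(u)=0$ for a.e. $u<0$; (b) $K(u)u^{-\frac12}\in L^1(\mathbb{R}_+)$; (c) $(\mathcal{M}K)(z)=F(z^{-1})$ for all $z\in\mathbb{C}$ with $\mathrm{Re}(z)=\frac12$. Conversely, if a function $K$ satisfies conditions (a), (b), and (c), where $F$ is holomorphic in some neighborhood of $\overline{\mathbb{D}}+1$, then $F(0)=0$ and $(\mathcal{H}_K)_1=F(\mathcal{C}_1)$.
   Context: $\overline{\mathbb{D}}$ is the closed unit disc in $\mathbb{C}$, so $\overline{\mathbb{D}}+1=\{z\in\mathbb{C}:|z-1|\le1\}$; $\mathbb{R}_+=(0,\infty)$. The Cesàro operator $\mathcal{C}$ in $L^2(\mathbb{R})$ is $(\mathcal{C}f)(x)=\frac1x\int_0^x f(t)\,dt=\int_0^1 f(ux)\,du$. $L^2[0,1]$ is viewed as a subspace of $L^2(\mathbb{R})$ (extension by zero), and for a bounded operator $A$ on $L^2(\mathbb{R})$, $A_1$ denotes the operator on $L^2[0,1]$ given by $A_1f=(Af)\chi_{(0,1)}$ for $f\in L^2[0,1]$. Thus $\mathcal{C}_1$ is the Cesàro operator in $L^2[0,1]$; its spectrum is $\overline{\mathbb{D}}+1$, and $F(\mathcal{C}_1)$ is defined by the holomorphic (Riesz–Dunford) functional calculus. For a measurable $K$ on $\mathbb{R}$ with $K(u)|u|^{-1/2}\in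 L^1(\mathbb{R})$, $\mathcal{H}_K$ is the bounded operator in $L^2(\mathbb{R})$ given by $(\mathcal{H}_Kf)(x)=\int_{\mathbb{R}}K(u)f(ux)\,du$. The Mellin transform is $(\mathcal{M}K)(z)=\int_{(0,+\infty)}K(u)u^{z-1}\,du$. *)

theory Defs
  imports "HOL-Complex_Analysis.Complex_Analysis"
begin

section \<open>The Hilbert space of square-integrable functions on the line\<close>

definition sq_integrable :: "(real \<Rightarrow> complex) \<Rightarrow> bool" where
  "sq_integrable f \<longleftrightarrow>
     f \<in> borel_measurable lebesgue \<and> integrable lebesgue (\<lambda>x. (cmod (f x))\<^sup>2)"

definition eq_l2 :: "(real \<Rightarrow> complex) \<Rightarrow> (real \<Rightarrow> complex) \<Rightarrow> bool" where
  "eq_l2 f g \<longleftrightarrow> sq_integrable f \<and> sq_integrable g \<and> (AE x in lebesgue. f x = g x)"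

lemma sq_integrable_zero: "sq_integrable (\<lambda>x. 0)"
  by (simp add: sq_integrable_def)

lemma sq_integrable_bound:
  assumes "f \<in> borel_measurable lebesgue" "integrable lebesgue g"
    and "\<And>x. (cmod (f x))\<^sup>2 \<le> g x"
  shows "sq_integrable f"
  unfolding sq_integrable_def
proof
  show "integrable lebesgue (\<lambda>x. (cmod (f x))\<^sup>2)"
  proof (rule Bochner_Integration.integrable_bound[OF assms(2)])
    show "(\<lambda>x. (cmod (f x))\<^sup>2) \<in> borel_measurable lebesgue"
      using assms(1) by measurable
    show "AE x in lebesgue. norm ((cmod (f x))\<^sup>2) \<le> norm (g x)"
    proof (rule AE_I2)
      fix x show "norm ((cmod (f x))\<^sup>2) \<le> norm (g x)"
        using assms(3)[of x] by simp
    qed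
  qed
qed (fact assms(1))

lemma sq_integrable_add:
  assumes "sq_integrable f" "sq_integrable g"
  shows "sq_integrable (\<lambda>x. f x + g x)"
proof (rule sq_integrable_bound)
  show "(\<lambda>x. f x + g x) \<in> borel_measurable lebesgue"
    using assms by (auto simp: sq_integrable_def)
  show "integrable lebesgue (\<lambda>x. 2 * (cmod (f x))\<^sup>2 + 2 * (cmod (g x))\<^sup>2)"
    using assms by (auto simp: sq_integrable_def)
  fix x
  have "(cmod (f x + g x))\<^sup>2 \<le> (cmod (f x) + cmod (g x))\<^sup>2"
    by (intro power_mono norm_triangle_ineq) auto
  also have "\<dots> \<le> 2 * (cmod (f x))\<^sup>2 + 2 * (cmod (g x))\<^sup>2"
    using sum_squares_bound[of "cmod (f x)" "cmod (g x)"] by (simp add: power2_sum)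
  finally show "(cmod (f x + g x))\<^sup>2 \<le> 2 * (cmod (f x))\<^sup>2 + 2 * (cmod (g x))\<^sup>2" .
qed

lemma sq_integrable_cmult:
  assumes "sq_integrable f"
  shows "sq_integrable (\<lambda>x. c * f x)"
  using assms by (auto simp: sq_integrable_def norm_mult power_mult_distrib)

lemma sq_integrable_scaleR:
  assumes "sq_integrable f"
  shows "sq_integrable (\<lambda>x. r *\<^sub>R f x)"
  using sq_integrable_cmult[OF assms, of "of_real r"] by (simp add: scaleR_conv_of_real)

lemma sq_integrable_uminus:
  assumes "sq_integrable f"
  shows "sq_integrable (\<lambda>x. - f x)"
  using sq_integrable_cmult[OF assms, of "-1"] by simp

lemma sq_integrable_diff:
  assumes "sq_integrable f" "sq_integrable g"
  shows "sq_integrable (\<lambda>x. f x - g x)"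
  using sq_integrable_add[OF assms(1) sq_integrable_uminus[OF assms(2)]] by simp

lemma sq_integrable_cut:
  assumes "sq_integrable f"
  shows "sq_integrable (\<lambda>x. indicator {0<..<1} x *\<^sub>R f x)"
proof (rule sq_integrable_bound)
  have "{0<..<1::real} \<in> sets lebesgue" by simp
  then show "(\<lambda>x. indicator {0<..<1} x *\<^sub>R f x) \<in> borel_measurable lebesgue"
    using assms by (intro borel_measurable_scaleR borel_measurable_indicator)
      (auto simp: sq_integrable_def)
  show "integrable lebesgue (\<lambda>x. (cmod (f x))\<^sup>2)"
    using assms by (auto simp: sq_integrable_def)
qed (auto simp: indicator_def)

lemma integrable_inner_sq:
  assumes "sq_integrable f" "sq_integrable g"
  shows "integrable lebesgue (\<lambda>x. f x \<bullet> g x)"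
proof (rule Bochner_Integration.integrable_bound)
  show "integrable lebesgue (\<lambda>x. (cmod (f x))\<^sup>2 + (cmod (g x))\<^sup>2)"
    using assms by (auto simp: sq_integrable_def)
  show "(\<lambda>x. f x \<bullet> g x) \<in> borel_measurable lebesgue"
    using assms by (auto simp: sq_integrable_def)
  show "AE x in lebesgue. norm (f x \<bullet> g x) \<le> norm ((cmod (f x))\<^sup>2 + (cmod (g x))\<^sup>2)"
  proof (rule AE_I2)
    fix x
    have "norm (f x \<bullet> g x) \<le> cmod (f x) * cmod (g x)"
      by (simp add: Cauchy_Schwarz_ineq2)
    also have "\<dots> \<le> 2 * cmod (f x) * cmod (g x)" by simp
    also have "\<dots> \<le> (cmod (f x))\<^sup>2 + (cmod (g x))\<^sup>2" by (rule sum_squares_bound)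
    finally show "norm (f x \<bullet> g x) \<le> norm ((cmod (f x))\<^sup>2 + (cmod (g x))\<^sup>2)" by simp
  qed
qed

quotient_type l2 = "real \<Rightarrow> complex" / partial: eq_l2
  morphisms rep_l2 abs_l2
proof (rule part_equivpI)
  show "\<exists>f. eq_l2 f f"
    by (rule exI[of _ "\<lambda>x. 0"]) (simp add: eq_l2_def sq_integrable_zero)
  show "symp eq_l2"
    by (rule sympI) (auto simp: eq_l2_def elim: eventually_mono)
  show "transp eq_l2"
    by (rule transpI) (auto simp: eq_l2_def elim: eventually_elim2)
qed

text \<open>
  The real inner product below is the real part of the usual complex one, so the induced norm is
  the usual \<open>L\<^sup>2\<close> norm.
\<close>

instantiation l2 :: real_inner
begin

lift_definition zero_l2 :: l2 is "\<lambda>x. 0"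
  by (simp add: eq_l2_def sq_integrable_zero)

lift_definition plus_l2 :: "l2 \<Rightarrow> l2 \<Rightarrow> l2" is "\<lambda>f g x. f x + g x"
  by (auto simp: eq_l2_def sq_integrable_add elim: eventually_elim2)

lift_definition minus_l2 :: "l2 \<Rightarrow> l2 \<Rightarrow> l2" is "\<lambda>f g x. f x - g x"
  by (auto simp: eq_l2_def sq_integrable_diff elim: eventually_elim2)

lift_definition uminus_l2 :: "l2 \<Rightarrow> l2" is "\<lambda>f x. - f x"
  by (auto simp: eq_l2_def sq_integrable_uminus elim: eventually_mono)

lift_definition scaleR_l2 :: "real \<Rightarrow> l2 \<Rightarrow> l2" is "\<lambda>r f x. r *\<^sub>R f x"
  by (auto simp: eq_l2_def sq_integrable_scaleR elim: eventually_mono)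

lift_definition inner_l2 :: "l2 \<Rightarrow> l2 \<Rightarrow> real" is "\<lambda>f g. LINT x|lebesgue. f x \<bullet> g x"
  by (rule integral_cong_AE)
    (auto simp: eq_l2_def sq_integrable_def elim: eventually_elim2)

definition norm_l2 :: "l2 \<Rightarrow> real" where "norm_l2 f = sqrt (f \<bullet> f)"

definition sgn_l2 :: "l2 \<Rightarrow> l2" where "sgn_l2 f = inverse (norm f) *\<^sub>R f"

definition dist_l2 :: "l2 \<Rightarrow> l2 \<Rightarrow> real" where "dist_l2 f g = norm (f - g)"

definition uniformity_l2 :: "(l2 \<times> l2) filter" where
  "uniformity_l2 = (INF e\<in>{0<..}. principal {(x, y). dist x y < e})"

definition open_l2 :: "l2 set \<Rightarrow> bool" where
  "open_l2 U \<longleftrightarrow> (\<forall>x\<in>U. \<forall>\<^sub>F (x', y) in uniformity. x' = x \<longrightarrow> y \<in> U)"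

instance
proof
  fix f g h :: l2 and r s :: real and U :: "l2 set"
  show "f + g + h = f + (g + h)"
    by transfer (auto simp: eq_l2_def sq_integrable_add add.assoc)
  show "f + g = g + f"
    by transfer (auto simp: eq_l2_def sq_integrable_add add.commute)
  show "0 + f = f"
    by transfer (auto simp: eq_l2_def)
  show "- f + f = 0"
    by transfer (auto simp: eq_l2_def sq_integrable_zero)
  show "f - g = f + - g"
    by transfer (auto simp: eq_l2_def sq_integrable_diff)
  show "r *\<^sub>R (f + g) = r *\<^sub>R f + r *\<^sub>R g"
    by transfer (simp add: eq_l2_def sq_integrable_add sq_integrable_scaleR scaleR_add_right)
  show "(r + s) *\<^sub>R f = r *\<^sub>R f + s *\<^sub>R f"
    by transfer (simp add: eq_l2_def sq_integrable_add sq_integrable_scaleR scaleR_add_left)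
  show "r *\<^sub>R s *\<^sub>R f = (r * s) *\<^sub>R f"
    by transfer (simp add: eq_l2_def sq_integrable_scaleR)
  show "1 *\<^sub>R f = f"
    by transfer (simp add: eq_l2_def)
  show "sgn f = inverse (norm f) *\<^sub>R f" by (rule sgn_l2_def)
  show "dist f g = norm (f - g)" by (rule dist_l2_def)
  show "uniformity = (INF e\<in>{0<..}. principal {(x, y :: l2). dist x y < e})"
    by (rule uniformity_l2_def)
  show "open U \<longleftrightarrow> (\<forall>x\<in>U. \<forall>\<^sub>F (x', y) in uniformity. x' = x \<longrightarrow> y \<in> U)"
    by (rule open_l2_def)
  show "norm f = sqrt (f \<bullet> f)" by (rule norm_l2_def)
  show "f \<bullet> g = g \<bullet> f"
    by transfer (simp add: inner_commute)
  show "(f + g) \<bullet> h = f \<bullet> h + g \<bullet> h"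
    by transfer (simp add: inner_add_left eq_l2_def integrable_inner_sq)
  show "(r *\<^sub>R f) \<bullet> g = r * (f \<bullet> g)"
    by transfer (simp add: eq_l2_def)
  show "0 \<le> f \<bullet> f"
    by transfer (simp add: integral_nonneg_AE)
  show "f \<bullet> f = 0 \<longleftrightarrow> f = 0"
  proof transfer
    fix f assume f: "eq_l2 f f"
    hence "integrable lebesgue (\<lambda>x. f x \<bullet> f x)"
      by (simp add: eq_l2_def integrable_inner_sq)
    hence "(LINT x|lebesgue. f x \<bullet> f x) = 0 \<longleftrightarrow> (AE x in lebesgue. f x \<bullet> f x = 0)"
      by (intro integral_nonneg_eq_0_iff_AE) auto
    thus "(LINT x|lebesgue. f x \<bullet> f x) = 0 \<longleftrightarrow> eq_l2 f (\<lambda>x. 0)"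
      using f by (simp add: eq_l2_def sq_integrable_zero)
  qed
qed

end

lemma norm_abs_l2:
  assumes "sq_integrable f"
  shows "norm (abs_l2 f) = sqrt (LINT x|lebesgue. (cmod (f x))\<^sup>2)"
  using assms
  by (simp add: norm_l2_def inner_l2.abs_eq eq_l2_def power2_norm_eq_inner)

lemma sq_integrable_rep_l2: "sq_integrable (rep_l2 f)"
  using Quotient_rep_reflp[OF Quotient_l2, of f] by (simp add: eq_l2_def)

lemma abs_rep_l2: "abs_l2 (rep_l2 f) = f"
  by (rule Quotient_abs_rep[OF Quotient_l2])

lemma abs_l2_eqI: "eq_l2 f g \<Longrightarrow> abs_l2 f = abs_l2 g"
  by (rule Quotient_rel_abs[OF Quotient_l2])

lemma eq_l2_rep_abs: "sq_integrable f \<Longrightarrow> eq_l2 (rep_l2 (abs_l2 f)) f"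
  using Quotient_rel_rep[OF Quotient_l2, of "abs_l2 f" "abs_l2 (rep_l2 (abs_l2 f))"]
    Quotient_rel[OF Quotient_l2, of "rep_l2 (abs_l2 f)" f] sq_integrable_rep_l2[of "abs_l2 f"]
  by (simp add: eq_l2_def abs_rep_l2)

lift_definition scaleC_l2 :: "complex \<Rightarrow> l2 \<Rightarrow> l2" is "\<lambda>c f x. c * f x"
  by (auto simp: eq_l2_def sq_integrable_cmult elim: eventually_mono)

lemma norm_scaleC_l2: "norm (scaleC_l2 c f) = cmod c * norm f"
proof -
  have "scaleC_l2 c f \<bullet> scaleC_l2 c f = (cmod c)\<^sup>2 * (f \<bullet> f)"
    by transfer (simp add: power2_norm_eq_inner[symmetric] norm_mult power_mult_distrib
        flip: integral_mult_right_zero)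
  thus ?thesis by (simp add: norm_l2_def real_sqrt_mult)
qed

lemma bounded_linear_scaleC_l2: "bounded_linear (scaleC_l2 c)"
proof (rule bounded_linear_intro)
  show "scaleC_l2 c (f + g) = scaleC_l2 c f + scaleC_l2 c g" for f g
    by transfer (simp add: eq_l2_def sq_integrable_cmult sq_integrable_add algebra_simps)
  show "scaleC_l2 c (r *\<^sub>R f) = r *\<^sub>R scaleC_l2 c f" for r f
    by transfer (simp add: eq_l2_def sq_integrable_cmult sq_integrable_scaleR scaleR_conv_of_real)
  show "norm (scaleC_l2 c f) \<le> norm f * cmod c" for f
    by (simp add: norm_scaleC_l2)
qed

lift_definition cut_l2 :: "l2 \<Rightarrow> l2" is "\<lambda>f x. indicator {0<..<1} x *\<^sub>R f x"
  by (auto simp: eq_l2_def sq_integrable_cut elim: eventually_mono)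

lemma cut_cut_l2 [simp]: "cut_l2 (cut_l2 f) = cut_l2 f"
  by transfer (simp add: eq_l2_def sq_integrable_cut flip: indicator_inter_arith)

lemma norm_cut_l2: "norm (cut_l2 f) \<le> norm f"
proof -
  have "cut_l2 f \<bullet> cut_l2 f \<le> f \<bullet> f"
  proof transfer
    fix f assume f: "eq_l2 f f"
    show "(LINT x|lebesgue. (indicat_real {0<..<1} x *\<^sub>R f x) \<bullet> (indicat_real {0<..<1} x *\<^sub>R f x))
        \<le> (LINT x|lebesgue. f x \<bullet> f x)"
      using f by (intro integral_mono integrable_inner_sq sq_integrable_cut)
        (auto simp: eq_l2_def indicator_def)
  qed
  thus ?thesis by (simp add: norm_l2_def)
qed

lemma bounded_linear_cut_l2: "bounded_linear cut_l2"
proof (rule bounded_linear_intro)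
  show "cut_l2 (f + g) = cut_l2 f + cut_l2 g" for f g
    by transfer (simp add: eq_l2_def sq_integrable_cut sq_integrable_add scaleR_add_right)
  show "cut_l2 (r *\<^sub>R f) = r *\<^sub>R cut_l2 f" for r f
    by transfer (simp add: eq_l2_def sq_integrable_cut sq_integrable_scaleR
        scaleR_left_commute del: scaleR_scaleR)
  show "norm (cut_l2 f) \<le> norm f * 1" for f
    by (simp add: norm_cut_l2)
qed

lemma cut_scaleC_l2: "cut_l2 (scaleC_l2 c f) = scaleC_l2 c (cut_l2 f)"
  by transfer (simp add: eq_l2_def sq_integrable_cut sq_integrable_cmult)


section \<open>The subspace of functions supported in the unit interval\<close>

typedef l2_unit = "{f :: l2. cut_l2 f = f}"
  by (rule exI[of _ "cut_l2 0"]) simp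

setup_lifting type_definition_l2_unit

instantiation l2_unit :: real_inner
begin

lift_definition zero_l2_unit :: l2_unit is 0
  by (rule linear_0[OF bounded_linear.linear[OF bounded_linear_cut_l2]])

lift_definition plus_l2_unit :: "l2_unit \<Rightarrow> l2_unit \<Rightarrow> l2_unit" is "(+)"
  by (simp add: linear_add[OF bounded_linear.linear[OF bounded_linear_cut_l2]])

lift_definition minus_l2_unit :: "l2_unit \<Rightarrow> l2_unit \<Rightarrow> l2_unit" is "(-)"
  by (simp add: linear_diff[OF bounded_linear.linear[OF bounded_linear_cut_l2]])

lift_definition uminus_l2_unit :: "l2_unit \<Rightarrow> l2_unit" is uminus
  by (simp add: linear_neg[OF bounded_linear.linear[OF bounded_linear_cut_l2]])

lift_definition scaleR_l2_unit :: "real \<Rightarrow> l2_unit \<Rightarrow> l2_unit" is "(*\<^sub>R)"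
  by (simp add: linear_scale[OF bounded_linear.linear[OF bounded_linear_cut_l2]])

lift_definition inner_l2_unit :: "l2_unit \<Rightarrow> l2_unit \<Rightarrow> real" is "(\<bullet>)" .

lift_definition norm_l2_unit :: "l2_unit \<Rightarrow> real" is norm .

definition sgn_l2_unit :: "l2_unit \<Rightarrow> l2_unit" where
  "sgn_l2_unit f = inverse (norm f) *\<^sub>R f"

definition dist_l2_unit :: "l2_unit \<Rightarrow> l2_unit \<Rightarrow> real" where
  "dist_l2_unit f g = norm (f - g)"

definition uniformity_l2_unit :: "(l2_unit \<times> l2_unit) filter" where
  "uniformity_l2_unit = (INF e\<in>{0<..}. principal {(x, y). dist x y < e})"

definition open_l2_unit :: "l2_unit set \<Rightarrow> bool" where
  "open_l2_unit U \<longleftrightarrow> (\<forall>x\<in>U. \<forall>\<^sub>F (x', y) in uniformity. x' = x \<longrightarrow> y \<in> U)"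

instance
proof
  fix f g h :: l2_unit and r s :: real and U :: "l2_unit set"
  show "f + g + h = f + (g + h)" by transfer simp
  show "f + g = g + f" by transfer simp
  show "0 + f = f" by transfer simp
  show "- f + f = 0" by transfer simp
  show "f - g = f + - g" by transfer simp
  show "r *\<^sub>R (f + g) = r *\<^sub>R f + r *\<^sub>R g" by transfer (rule scaleR_add_right)
  show "(r + s) *\<^sub>R f = r *\<^sub>R f + s *\<^sub>R f" by transfer (rule scaleR_add_left)
  show "r *\<^sub>R s *\<^sub>R f = (r * s) *\<^sub>R f" by transfer simp
  show "1 *\<^sub>R f = f" by transfer simp
  show "sgn f = inverse (norm f) *\<^sub>R f" by (rule sgn_l2_unit_def)
  show "dist f g = norm (f - g)" by (rule dist_l2_unit_def)
  show "uniformity = (INF e\<in>{0<..}. principal {(x, y :: l2_unit). dist x y < e})"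
    by (rule uniformity_l2_unit_def)
  show "open U \<longleftrightarrow> (\<forall>x\<in>U. \<forall>\<^sub>F (x', y) in uniformity. x' = x \<longrightarrow> y \<in> U)"
    by (rule open_l2_unit_def)
  show "norm f = sqrt (f \<bullet> f)" by transfer (rule norm_eq_sqrt_inner)
  show "f \<bullet> g = g \<bullet> f" by transfer (rule inner_commute)
  show "(f + g) \<bullet> h = f \<bullet> h + g \<bullet> h" by transfer (rule inner_add_left)
  show "(r *\<^sub>R f) \<bullet> g = r * (f \<bullet> g)" by transfer simp
  show "0 \<le> f \<bullet> f" by transfer simp
  show "f \<bullet> f = 0 \<longleftrightarrow> f = 0" by transfer simp
qed

end

lift_definition compression :: "(l2 \<Rightarrow>\<^sub>L l2) \<Rightarrow> l2_unit \<Rightarrow>\<^sub>L l2_unit" is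
  "\<lambda>A f. Abs_l2_unit (cut_l2 (A (Rep_l2_unit f)))"
proof -
  fix A :: "l2 \<Rightarrow> l2" assume A: "bounded_linear A"
  have R: "bounded_linear Rep_l2_unit"
    by (rule bounded_linear_intro[where K = 1])
      (simp_all add: plus_l2_unit.rep_eq scaleR_l2_unit.rep_eq norm_l2_unit.rep_eq)
  define B where "B = (\<lambda>f. cut_l2 (A (Rep_l2_unit f)))"
  have B: "bounded_linear B"
    unfolding B_def
    by (intro bounded_linear_compose[OF bounded_linear_cut_l2] bounded_linear_compose[OF A] R)
  have RB: "Rep_l2_unit (Abs_l2_unit (B f)) = B f" for f
    by (rule Abs_l2_unit_inverse) (simp add: B_def)
  from bounded_linear.bounded[OF B] obtain M where M: "norm (B f) \<le> norm f * M" for f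
    by blast
  have "bounded_linear (\<lambda>f. Abs_l2_unit (B f))"
  proof (rule bounded_linear_intro)
    show "Abs_l2_unit (B (f + g)) = Abs_l2_unit (B f) + Abs_l2_unit (B g)" for f g
      by (simp add: Rep_l2_unit_inject[symmetric] RB plus_l2_unit.rep_eq
          flip: linear_add[OF bounded_linear.linear[OF B]])
    show "Abs_l2_unit (B (r *\<^sub>R f)) = r *\<^sub>R Abs_l2_unit (B f)" for r f
      by (simp add: Rep_l2_unit_inject[symmetric] RB scaleR_l2_unit.rep_eq
          flip: linear_scale[OF bounded_linear.linear[OF B]])
    show "norm (Abs_l2_unit (B f)) \<le> norm f * M" for f
      using M[of f] by (simp add: norm_l2_unit.rep_eq RB)
  qed
  thus "bounded_linear (\<lambda>f. Abs_l2_unit (cut_l2 (A (Rep_l2_unit f))))"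
    by (simp add: B_def)
qed

text \<open>Multiplication by a complex scalar, as an operator; \<open>scalar_op 1\<close> is the identity.\<close>

lift_definition scalar_op :: "complex \<Rightarrow> l2_unit \<Rightarrow>\<^sub>L l2_unit" is
  "\<lambda>c f. Abs_l2_unit (scaleC_l2 c (Rep_l2_unit f))"
proof -
  fix c
  have R: "Rep_l2_unit (Abs_l2_unit (scaleC_l2 c (Rep_l2_unit f))) = scaleC_l2 c (Rep_l2_unit f)" for f
    using Rep_l2_unit[of f] by (intro Abs_l2_unit_inverse) (simp add: cut_scaleC_l2)
  show "bounded_linear (\<lambda>f. Abs_l2_unit (scaleC_l2 c (Rep_l2_unit f)))"
  proof (rule bounded_linear_intro)
    note lin = bounded_linear.linear[OF bounded_linear_scaleC_l2]
    show "Abs_l2_unit (scaleC_l2 c (Rep_l2_unit (f + g))) =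
        Abs_l2_unit (scaleC_l2 c (Rep_l2_unit f)) + Abs_l2_unit (scaleC_l2 c (Rep_l2_unit g))" for f g
      unfolding Rep_l2_unit_inject[symmetric] plus_l2_unit.rep_eq[of "Abs_l2_unit _"] R
      by (simp add: plus_l2_unit.rep_eq linear_add[OF lin])
    show "Abs_l2_unit (scaleC_l2 c (Rep_l2_unit (r *\<^sub>R f))) =
        r *\<^sub>R Abs_l2_unit (scaleC_l2 c (Rep_l2_unit f))" for r f
      unfolding Rep_l2_unit_inject[symmetric] scaleR_l2_unit.rep_eq[of _ "Abs_l2_unit _"] R
      by (simp add: scaleR_l2_unit.rep_eq linear_scale[OF lin])
    show "norm (Abs_l2_unit (scaleC_l2 c (Rep_l2_unit f))) \<le> norm f * cmod c" for f
      by (simp add: norm_l2_unit.rep_eq R norm_scaleC_l2)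
  qed
qed


section \<open>Hausdorff operators and the Cesaro operator on the line\<close>

lemma ex_borel_representative:
  fixes f :: "real \<Rightarrow> complex"
  assumes "f \<in> borel_measurable lebesgue"
  obtains g where "g \<in> borel_measurable borel" "AE x in lebesgue. f x = g x"
proof -
  have "(\<lambda>x. Re (f x)) \<in> borel_measurable lebesgue" "(\<lambda>x. Im (f x)) \<in> borel_measurable lebesgue"
    using assms by measurable
  then obtain p q where p: "p \<in> borel_measurable lborel" "AE x in lborel. Re (f x) = p x"
    and q: "q \<in> borel_measurable lborel" "AE x in lborel. Im (f x) = q x"
    using completion_ex_borel_measurable_real[of "\<lambda>x. Re (f x)" lborel]
      completion_ex_borel_measurable_real[of "\<lambda>x. Im (f x)" lborel] by blast
  have "AE x in lebesgue. f x = Complex (p x) (q x)"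
  proof (rule AE_completion)
    show "AE x in lborel. f x = Complex (p x) (q x)"
      using p(2) q(2) by eventually_elim (simp add: complex_eq_iff)
  qed
  moreover have "(\<lambda>x. Complex (p x) (q x)) \<in> borel_measurable borel"
    using p(1) q(1) by (auto intro: borel_measurable_complex_iff[THEN iffD2])
  ultimately show thesis using that by blast
qed

lemma AE_lebesgue_scale:
  fixes P :: "real \<Rightarrow> bool"
  assumes "AE x in lebesgue. P x" "c \<noteq> 0"
  shows "AE u in lebesgue. P (u * c)"
proof -
  from assms(1) obtain N where N: "N \<in> null_sets lebesgue" "{x. \<not> P x} \<subseteq> N"
    by (auto simp: eventually_ae_filter)
  have "negligible ((\<lambda>x. x / c) ` N)"
    using N(1) by (intro negligible_differentiable_image_negligible)
      (auto simp: negligible_iff_null_sets divide_inverse bounded_linear_mult_left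
        intro: bounded_linear_imp_differentiable_on)
  moreover have "{u. \<not> P (u * c)} \<subseteq> (\<lambda>x. x / c) ` N"
  proof
    fix u assume "u \<in> {u. \<not> P (u * c)}"
    hence "u * c \<in> N" using N(2) by auto
    thus "u \<in> (\<lambda>x. x / c) ` N" using \<open>c \<noteq> 0\<close> by (intro image_eqI[of _ _ "u * c"]) auto
  qed
  ultimately show ?thesis
    by (auto simp: eventually_ae_filter negligible_iff_null_sets)
qed

lemma AE_lebesgue_neq: "AE x :: real in lebesgue. x \<noteq> c"
  by (rule AE_completion[OF AE_lborel_singleton])

lemma schur_bound:
  fixes K f :: "real \<Rightarrow> complex"
  assumes [measurable]: "K \<in> borel_measurable borel" "f \<in> borel_measurable borel"
  defines "W \<equiv> \<integral>\<^sup>+u. ennreal (cmod (K u) / sqrt \<bar>u\<bar>) \<partial>lborel"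
    and "N \<equiv> \<integral>\<^sup>+x. ennreal ((cmod (f x))\<^sup>2) \<partial>lborel"
  shows "(\<integral>\<^sup>+x. (\<integral>\<^sup>+u. ennreal (cmod (K u * f (u * x))) \<partial>lborel)\<^sup>2 \<partial>lborel) \<le> W * (W * N)"
proof -
  have ne: "AE u :: real in lborel. u \<noteq> 0" by (rule AE_lborel_singleton)
  define h where "h = (\<lambda>u x. ennreal (cmod (K u) * sqrt \<bar>u\<bar> * (cmod (f (u * x)))\<^sup>2))"
  have [measurable]: "(\<lambda>(u, x). h u x) \<in> borel_measurable (lborel \<Otimes>\<^sub>M lborel)"
    unfolding h_def by measurable
  have pt: "(\<integral>\<^sup>+u. ennreal (cmod (K u * f (u * x))) \<partial>lborel)\<^sup>2 \<le> W * (\<integral>\<^sup>+u. h u x \<partial>lborel)" for x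
  proof -
    have "(\<integral>\<^sup>+u. ennreal (cmod (K u * f (u * x))) \<partial>lborel) =
        (\<integral>\<^sup>+u. ennreal (sqrt (cmod (K u) / sqrt \<bar>u\<bar>)) *
              ennreal (sqrt (cmod (K u) * sqrt \<bar>u\<bar>) * cmod (f (u * x))) \<partial>lborel)"
    proof (rule nn_integral_cong_AE, use ne in eventually_elim)
      fix u :: real assume "u \<noteq> 0"
      hence "sqrt (cmod (K u) / sqrt \<bar>u\<bar>) * sqrt (cmod (K u) * sqrt \<bar>u\<bar>) = cmod (K u)"
        by (simp flip: real_sqrt_mult)
      thus "ennreal (cmod (K u * f (u * x))) = ennreal (sqrt (cmod (K u) / sqrt \<bar>u\<bar>)) *
              ennreal (sqrt (cmod (K u) * sqrt \<bar>u\<bar>) * cmod (f (u * x)))"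
        by (simp add: norm_mult mult.assoc[symmetric] flip: ennreal_mult)
    qed
    also have "\<dots>\<^sup>2 \<le> (\<integral>\<^sup>+u. (ennreal (sqrt (cmod (K u) / sqrt \<bar>u\<bar>)))\<^sup>2 \<partial>lborel) *
        (\<integral>\<^sup>+u. (ennreal (sqrt (cmod (K u) * sqrt \<bar>u\<bar>) * cmod (f (u * x))))\<^sup>2 \<partial>lborel)"
      by (rule Cauchy_Schwarz_nn_integral) measurable
    also have "\<dots> = W * (\<integral>\<^sup>+u. h u x \<partial>lborel)"
      by (simp add: W_def h_def ennreal_power power_mult_distrib)
    finally show ?thesis .
  qed
  have "(\<integral>\<^sup>+x. (\<integral>\<^sup>+u. ennreal (cmod (K u * f (u * x))) \<partial>lborel)\<^sup>2 \<partial>lborel)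
      \<le> (\<integral>\<^sup>+x. W * (\<integral>\<^sup>+u. h u x \<partial>lborel) \<partial>lborel)"
    by (intro nn_integral_mono pt)
  also have "\<dots> = W * (\<integral>\<^sup>+x. (\<integral>\<^sup>+u. h u x \<partial>lborel) \<partial>lborel)"
    by (intro nn_integral_cmult) measurable
  also have "(\<integral>\<^sup>+x. (\<integral>\<^sup>+u. h u x \<partial>lborel) \<partial>lborel) = (\<integral>\<^sup>+u. (\<integral>\<^sup>+x. h u x \<partial>lborel) \<partial>lborel)"
    by (rule lborel_pair.Fubini') measurable
  also have "\<dots> = (\<integral>\<^sup>+u. ennreal (cmod (K u) / sqrt \<bar>u\<bar>) * N \<partial>lborel)"
  proof (rule nn_integral_cong_AE, use ne in eventually_elim)
    fix u :: real assume u: "u \<noteq> 0"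
    define X where "X = (\<integral>\<^sup>+x. ennreal ((cmod (f (u * x)))\<^sup>2) \<partial>lborel)"
    have N: "N = ennreal \<bar>u\<bar> * X"
      unfolding N_def X_def
      using nn_integral_real_affine[of "\<lambda>x. ennreal ((cmod (f x))\<^sup>2)" u 0] u by simp
    have "(\<integral>\<^sup>+x. h u x \<partial>lborel) = ennreal (cmod (K u) * sqrt \<bar>u\<bar>) * X"
      unfolding h_def X_def by (subst nn_integral_cmult[symmetric]) (auto simp: ennreal_mult)
    moreover have "cmod (K u) / sqrt \<bar>u\<bar> * \<bar>u\<bar> = cmod (K u) * sqrt \<bar>u\<bar>"
      using u by (simp add: field_simps)
    ultimately show "(\<integral>\<^sup>+x. h u x \<partial>lborel) = ennreal (cmod (K u) / sqrt \<bar>u\<bar>) * N"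
      by (simp add: N mult.assoc[symmetric] flip: ennreal_mult)
  qed
  also have "\<dots> = W * N"
    unfolding W_def by (intro nn_integral_multc) measurable
  finally show ?thesis .
qed

definition hausdorff_fun :: "(real \<Rightarrow> complex) \<Rightarrow> (real \<Rightarrow> complex) \<Rightarrow> real \<Rightarrow> complex" where
  "hausdorff_fun K f x = (LINT u|lebesgue. K u * f (u * x))"

definition hausdorff_kernel :: "(real \<Rightarrow> complex) \<Rightarrow> bool" where
  "hausdorff_kernel K \<longleftrightarrow> K \<in> borel_measurable lebesgue \<and>
     integrable lebesgue (\<lambda>u. K u * of_real (\<bar>u\<bar> powr (-1/2)))"

lemma hausdorff_fun_cong:
  assumes "AE x in lebesgue. f x = g x" "x \<noteq> 0"
    and "f \<in> borel_measurable lebesgue" "g \<in> borel_measurable lebesgue"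
    and "K \<in> borel_measurable lebesgue"
  shows "hausdorff_fun K f x = hausdorff_fun K g x"
  unfolding hausdorff_fun_def
proof (rule integral_cong_AE)
  show "(\<lambda>u. K u * f (u * x)) \<in> borel_measurable lebesgue"
    using borel_measurable_affine[OF assms(3,2), of 0] assms(5) by (simp add: mult.commute)
  show "(\<lambda>u. K u * g (u * x)) \<in> borel_measurable lebesgue"
    using borel_measurable_affine[OF assms(4,2), of 0] assms(5) by (simp add: mult.commute)
  show "AE u in lebesgue. K u * f (u * x) = K u * g (u * x)"
    using AE_lebesgue_scale[OF assms(1,2)] by eventually_elim simp
qed

lemma hausdorff_fun_props:
  assumes K: "hausdorff_kernel K" and f: "sq_integrable f"
  shows "AE x in lebesgue. integrable lebesgue (\<lambda>u. K u * f (u * x))"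
    and "sq_integrable (hausdorff_fun K f)"
    and "(LINT x|lebesgue. (cmod (hausdorff_fun K f x))\<^sup>2) \<le>
      (LINT u|lebesgue. cmod (K u * of_real (\<bar>u\<bar> powr (-1/2))))\<^sup>2 * (LINT x|lebesgue. (cmod (f x))\<^sup>2)"
proof -
  have Km: "K \<in> borel_measurable lebesgue" and fm: "f \<in> borel_measurable lebesgue"
    using K f by (auto simp: hausdorff_kernel_def sq_integrable_def)
  obtain k where k [measurable]: "k \<in> borel_measurable borel" and kK: "AE x in lebesgue. K x = k x"
    using ex_borel_representative[OF Km] .
  obtain g where g [measurable]: "g \<in> borel_measurable borel" and gf: "AE x in lebesgue. f x = g x"
    using ex_borel_representative[OF fm] .
  define W where "W = (LINT u|lebesgue. cmod (K u * of_real (\<bar>u\<bar> powr (-1/2))))"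
  define N where "N = (LINT x|lebesgue. (cmod (f x))\<^sup>2)"
  have W0: "W \<ge> 0" and N0: "N \<ge> 0" by (simp_all add: W_def N_def)
  have W: "(\<integral>\<^sup>+u. ennreal (cmod (k u) / sqrt \<bar>u\<bar>) \<partial>lborel) = ennreal W"
  proof -
    have "(\<integral>\<^sup>+u. ennreal (cmod (k u) / sqrt \<bar>u\<bar>) \<partial>lborel) =
        (\<integral>\<^sup>+u. ennreal (cmod (k u) / sqrt \<bar>u\<bar>) \<partial>lebesgue)"
      by (simp add: nn_integral_completion)
    also have "\<dots> = (\<integral>\<^sup>+u. ennreal (cmod (K u * of_real (\<bar>u\<bar> powr (-1/2)))) \<partial>lebesgue)"
    proof (rule nn_integral_cong_AE, use kK in eventually_elim)
      fix u :: real assume "K u = k u"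
      moreover have "\<bar>u\<bar> powr (-1/2) = inverse (sqrt \<bar>u\<bar>)"
        using powr_minus[of "\<bar>u\<bar>" "1/2"] by (simp add: powr_half_sqrt)
      ultimately show "ennreal (cmod (k u) / sqrt \<bar>u\<bar>) =
          ennreal (cmod (K u * of_real (\<bar>u\<bar> powr (-1/2))))"
        by (simp only: norm_mult norm_of_real divide_inverse) simp
    qed
    also have "\<dots> = ennreal W"
      unfolding W_def using K by (intro nn_integral_eq_integral) (auto simp: hausdorff_kernel_def)
    finally show ?thesis .
  qed
  have N: "(\<integral>\<^sup>+x. ennreal ((cmod (g x))\<^sup>2) \<partial>lborel) = ennreal N"
  proof -
    have "(\<integral>\<^sup>+x. ennreal ((cmod (g x))\<^sup>2) \<partial>lborel) = (\<integral>\<^sup>+x. ennreal ((cmod (g x))\<^sup>2) \<partial>lebesgue)"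
      by (simp add: nn_integral_completion)
    also have "\<dots> = (\<integral>\<^sup>+x. ennreal ((cmod (f x))\<^sup>2) \<partial>lebesgue)"
      by (rule nn_integral_cong_AE, use gf in eventually_elim) simp
    also have "\<dots> = ennreal N"
      unfolding N_def using f by (intro nn_integral_eq_integral) (auto simp: sq_integrable_def)
    finally show ?thesis .
  qed
  define P where "P = (\<lambda>x. \<integral>\<^sup>+u. ennreal (cmod (k u * g (u * x))) \<partial>lborel)"
  have [measurable]: "P \<in> borel_measurable borel" unfolding P_def by measurable
  have Pbound: "(\<integral>\<^sup>+x. (P x)\<^sup>2 \<partial>lborel) \<le> ennreal (W\<^sup>2 * N)"
    using schur_bound[OF k g] W0 N0 unfolding P_def W N
    by (simp add: power2_eq_square[of W] mult.assoc ennreal_mult)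
  have "AE x in lborel. (P x)\<^sup>2 \<noteq> \<infinity>"
    by (rule nn_integral_PInf_AE) (use Pbound in \<open>auto simp: top_unique\<close>)
  hence Pfin: "AE x in lborel. P x < \<infinity>"
    by eventually_elim (auto simp: power2_eq_square ennreal_mult_eq_top_iff simp flip: less_top)
  have ae: "AE u in lebesgue. K u * f (u * x) = k u * g (u * x)" if "x \<noteq> 0" for x
    using kK AE_lebesgue_scale[OF gf that] by eventually_elim simp
  have m1: "(\<lambda>u. K u * f (u * x)) \<in> borel_measurable lebesgue" if "x \<noteq> 0" for x
    using borel_measurable_affine[OF fm that, of 0] Km by (simp add: mult.commute)
  have m2: "(\<lambda>u. k u * g (u * x)) \<in> borel_measurable lebesgue" for x
    by (rule measurable_completion) simp
  define h where "h = (\<lambda>x. LINT u|lborel. k u * g (u * x))"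
  have [measurable]: "h \<in> borel_measurable borel" unfolding h_def by measurable
  have hm: "h \<in> borel_measurable lebesgue" by (rule measurable_completion) simp
  have hausdorff_h: "hausdorff_fun K f x = h x" if "x \<noteq> 0" for x
    unfolding hausdorff_fun_def h_def
    using integral_cong_AE[OF m1[OF that] m2 ae[OF that]] by (simp add: integral_completion)
  have AE_h: "AE x in lebesgue. h x = hausdorff_fun K f x"
    using AE_lebesgue_neq[of 0] by eventually_elim (simp add: hausdorff_h)
  have hausm: "hausdorff_fun K f \<in> borel_measurable lebesgue"
    by (rule borel_measurable_AE[OF hm AE_h])
  have int: "integrable lborel (\<lambda>u. k u * g (u * x))" if "P x < \<infinity>" for x
    using that unfolding P_def by (intro integrableI_bounded) auto
  have "AE x in lebesgue. P x < \<infinity>" by (rule AE_completion[OF Pfin])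
  thus "AE x in lebesgue. integrable lebesgue (\<lambda>u. K u * f (u * x))"
    using AE_lebesgue_neq[of 0]
  proof eventually_elim
    fix x :: real assume "P x < \<infinity>" "x \<noteq> 0"
    have "integrable lebesgue (\<lambda>u. k u * g (u * x))"
      using int[OF \<open>P x < \<infinity>\<close>] by (simp add: integrable_completion)
    thus "integrable lebesgue (\<lambda>u. K u * f (u * x))"
      using integrable_cong_AE[OF m1[OF \<open>x \<noteq> 0\<close>] m2 ae[OF \<open>x \<noteq> 0\<close>]] by simp
  qed
  have hP: "ennreal (cmod (h x)) \<le> P x" for x
  proof (cases "P x < \<infinity>")
    case True
    thus ?thesis using integral_norm_bound_ennreal[OF int[OF True]] by (simp add: h_def P_def)
  qed (simp flip: less_top)
  have nn: "(\<integral>\<^sup>+x. ennreal ((cmod (hausdorff_fun K f x))\<^sup>2) \<partial>lebesgue) \<le> ennreal (W\<^sup>2 * N)"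
  proof -
    have "(\<integral>\<^sup>+x. ennreal ((cmod (hausdorff_fun K f x))\<^sup>2) \<partial>lebesgue) =
        (\<integral>\<^sup>+x. ennreal ((cmod (h x))\<^sup>2) \<partial>lebesgue)"
      by (rule nn_integral_cong_AE, use AE_h in eventually_elim) simp
    also have "\<dots> = (\<integral>\<^sup>+x. (ennreal (cmod (h x)))\<^sup>2 \<partial>lborel)"
      by (simp add: nn_integral_completion ennreal_power)
    also have "\<dots> \<le> (\<integral>\<^sup>+x. (P x)\<^sup>2 \<partial>lborel)"
      by (intro nn_integral_mono power_mono hP) auto
    finally show ?thesis using Pbound by (rule order_trans)
  qed
  have hint: "integrable lebesgue (\<lambda>x. (cmod (hausdorff_fun K f x))\<^sup>2)"
  proof (rule integrableI_bounded)
    show "(\<lambda>x. (cmod (hausdorff_fun K f x))\<^sup>2) \<in> borel_measurable lebesgue"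
      using hausm by measurable
    show "(\<integral>\<^sup>+x. ennreal (norm ((cmod (hausdorff_fun K f x))\<^sup>2)) \<partial>lebesgue) < \<infinity>"
      using nn by (simp add: order.strict_trans1)
  qed
  thus "sq_integrable (hausdorff_fun K f)"
    using hausm by (simp add: sq_integrable_def)
  have "ennreal (LINT x|lebesgue. (cmod (hausdorff_fun K f x))\<^sup>2) \<le> ennreal (W\<^sup>2 * N)"
    using nn nn_integral_eq_integral[OF hint] by simp
  thus "(LINT x|lebesgue. (cmod (hausdorff_fun K f x))\<^sup>2) \<le>
      (LINT u|lebesgue. cmod (K u * of_real (\<bar>u\<bar> powr (-1/2))))\<^sup>2 * (LINT x|lebesgue. (cmod (f x))\<^sup>2)"
    using N0 unfolding W_def[symmetric] N_def[symmetric] by simp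
qed

lemma bounded_linear_hausdorff_fun:
  assumes K: "hausdorff_kernel K"
  shows "bounded_linear (\<lambda>f. abs_l2 (hausdorff_fun K (rep_l2 f)))"
proof -
  define T where "T = (\<lambda>f. abs_l2 (hausdorff_fun K (rep_l2 f)))"
  have Km: "K \<in> borel_measurable lebesgue" using K by (simp add: hausdorff_kernel_def)
  have T_abs: "T (abs_l2 f) = abs_l2 (hausdorff_fun K f)" if f: "sq_integrable f" for f
    unfolding T_def
  proof (rule abs_l2_eqI)
    have eq: "eq_l2 (rep_l2 (abs_l2 f)) f" by (rule eq_l2_rep_abs[OF f])
    have "AE x in lebesgue. hausdorff_fun K (rep_l2 (abs_l2 f)) x = hausdorff_fun K f x"
      using AE_lebesgue_neq[of 0]
    proof eventually_elim
      fix x :: real assume "x \<noteq> 0"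
      thus "hausdorff_fun K (rep_l2 (abs_l2 f)) x = hausdorff_fun K f x"
        using eq Km by (intro hausdorff_fun_cong) (auto simp: eq_l2_def sq_integrable_def)
    qed
    thus "eq_l2 (hausdorff_fun K (rep_l2 (abs_l2 f))) (hausdorff_fun K f)"
      by (simp add: eq_l2_def hausdorff_fun_props(2)[OF K] f sq_integrable_rep_l2)
  qed
  have "bounded_linear T"
  proof (rule bounded_linear_intro)
    fix f g :: l2 and r :: real
    define f' g' where "f' = rep_l2 f" and "g' = rep_l2 g"
    have f': "sq_integrable f'" "f = abs_l2 f'" and g': "sq_integrable g'" "g = abs_l2 g'"
      by (simp_all add: f'_def g'_def sq_integrable_rep_l2 abs_rep_l2)
    note sq = hausdorff_fun_props(2)[OF K]
    have "T (f + g) = abs_l2 (hausdorff_fun K (\<lambda>x. f' x + g' x))"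
      using f' g' by (simp add: plus_l2.abs_eq eq_l2_def T_abs sq_integrable_add)
    also have "\<dots> = abs_l2 (\<lambda>x. hausdorff_fun K f' x + hausdorff_fun K g' x)"
    proof (rule abs_l2_eqI)
      have "AE x in lebesgue. hausdorff_fun K (\<lambda>x. f' x + g' x) x =
          hausdorff_fun K f' x + hausdorff_fun K g' x"
        using hausdorff_fun_props(1)[OF K f'(1)] hausdorff_fun_props(1)[OF K g'(1)]
        by eventually_elim (simp add: hausdorff_fun_def ring_distribs)
      thus "eq_l2 (hausdorff_fun K (\<lambda>x. f' x + g' x))
          (\<lambda>x. hausdorff_fun K f' x + hausdorff_fun K g' x)"
        using f' g' by (simp add: eq_l2_def sq sq_integrable_add)
    qed
    also have "\<dots> = T f + T g"
      using f' g' by (simp add: T_abs plus_l2.abs_eq eq_l2_def sq)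
    finally show "T (f + g) = T f + T g" .
    have eq: "hausdorff_fun K (\<lambda>x. r *\<^sub>R f' x) = (\<lambda>x. r *\<^sub>R hausdorff_fun K f' x)"
      by (rule ext) (simp add: hausdorff_fun_def)
    have "T (r *\<^sub>R f) = abs_l2 (hausdorff_fun K (\<lambda>x. r *\<^sub>R f' x))"
      using f' by (simp add: scaleR_l2.abs_eq eq_l2_def T_abs sq_integrable_scaleR)
    also have "\<dots> = r *\<^sub>R T f"
      unfolding eq using f' by (simp add: T_abs scaleR_l2.abs_eq eq_l2_def sq)
    finally show "T (r *\<^sub>R f) = r *\<^sub>R T f" .
    have "norm (T f) \<le> sqrt ((LINT u|lebesgue. cmod (K u * of_real (\<bar>u\<bar> powr (-1/2))))\<^sup>2 *
        (LINT x|lebesgue. (cmod (f' x))\<^sup>2))"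
      using f' hausdorff_fun_props(3)[OF K f'(1)] by (simp add: T_abs norm_abs_l2 sq)
    also have "\<dots> = norm f * (LINT u|lebesgue. cmod (K u * of_real (\<bar>u\<bar> powr (-1/2))))"
      using f' by (simp add: norm_abs_l2 real_sqrt_mult)
    finally show "norm (T f) \<le> norm f * (LINT u|lebesgue. cmod (K u * of_real (\<bar>u\<bar> powr (-1/2))))" .
  qed
  thus ?thesis by (simp add: T_def)
qed

text \<open>
  \<^const>\<open>Blinfun\<close> is meaningful here exactly because of the boundedness just proved, that is, for
  kernels satisfying \<^const>\<open>hausdorff_kernel\<close>.
\<close>

definition hausdorff :: "(real \<Rightarrow> complex) \<Rightarrow> l2 \<Rightarrow>\<^sub>L l2" where
  "hausdorff K = Blinfun (\<lambda>f. abs_l2 (hausdorff_fun K (rep_l2 f)))"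

lemma hausdorff_apply:
  "hausdorff_kernel K \<Longrightarrow> blinfun_apply (hausdorff K) f = abs_l2 (hausdorff_fun K (rep_l2 f))"
  unfolding hausdorff_def by (simp add: bounded_linear_Blinfun_apply bounded_linear_hausdorff_fun)

lemma hausdorff_kernel_half_line:
  assumes "K \<in> borel_measurable lebesgue" and "AE u in lebesgue. u < 0 \<longrightarrow> K u = 0"
    and "set_integrable lebesgue {0<..} (\<lambda>u. K u * of_real (u powr (-1/2)))"
  shows "hausdorff_kernel K"
  unfolding hausdorff_kernel_def
proof
  have "(\<lambda>u::real. \<bar>u\<bar> powr (-1/2)) \<in> borel_measurable lebesgue"
    by (rule measurable_completion) simp
  hence "(\<lambda>u. complex_of_real (\<bar>u\<bar> powr (-1/2))) \<in> borel_measurable lebesgue"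
    by measurable
  hence m: "(\<lambda>u. K u * of_real (\<bar>u\<bar> powr (-1/2))) \<in> borel_measurable lebesgue"
    using assms(1) by (rule borel_measurable_times[rotated])
  show "integrable lebesgue (\<lambda>u. K u * of_real (\<bar>u\<bar> powr (-1/2)))"
  proof (rule integrable_cong_AE_imp[OF assms(3)[unfolded set_integrable_def] m])
    show "AE u in lebesgue. indicator {0<..} u *\<^sub>R (K u * of_real (u powr (-1/2))) =
        K u * of_real (\<bar>u\<bar> powr (-1/2))"
      using assms(2) AE_lebesgue_neq[of 0]
    proof eventually_elim
      fix u :: real assume "u < 0 \<longrightarrow> K u = 0" "u \<noteq> 0"
      thus "indicator {0<..} u *\<^sub>R (K u * of_real (u powr (-1/2))) =
          K u * of_real (\<bar>u\<bar> powr (-1/2))"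
        by (cases "u > 0") auto
    qed
  qed
qed (fact assms(1))

definition cesaro_fun :: "(real \<Rightarrow> complex) \<Rightarrow> real \<Rightarrow> complex" where
  "cesaro_fun f x = (LINT t=0..x|lebesgue. f t) / of_real x"

lemma hausdorff_kernel_cesaro: "hausdorff_kernel (indicator {0<..<1})"
proof -
  have m: "indicator {0<..<1::real} \<in> borel_measurable lebesgue"
    by (rule borel_measurable_indicator) simp
  have "(\<lambda>u::real. u powr (-1/2)) absolutely_integrable_on {0..1}"
    by (rule nonnegative_absolutely_integrable_1[OF integrable_on_powr_from_0]) auto
  hence "(\<lambda>u::real. u powr (-1/2)) absolutely_integrable_on {0<..<1}"
    by (rule set_integrable_subset) auto
  hence "integrable lebesgue (\<lambda>u. complex_of_real (indicator {0<..<1} u * u powr (-1/2)))"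
    unfolding set_integrable_def real_scaleR_def by (rule integrable_of_real)
  also have "(\<lambda>u. complex_of_real (indicator {0<..<1} u * u powr (-1/2))) =
      (\<lambda>u. indicator {0<..<1} u * of_real (\<bar>u\<bar> powr (-1/2)))"
    by (auto simp: indicator_def)
  finally show ?thesis by (simp add: hausdorff_kernel_def m)
qed

lemma cesaro_fun_eq_hausdorff:
  assumes "x \<noteq> 0"
  shows "cesaro_fun f x = hausdorff_fun (indicator {0<..<1}) f x"
proof (cases "x > 0")
  case True
  have "(LINT t=0..x|lebesgue. f t) = (LINT t|lebesgue. indicator {0<..<x} t *\<^sub>R f t)"
    using True by (simp add: interval_lebesgue_integral_def set_lebesgue_integral_def zero_ereal_def)
  also have "\<dots> = x *\<^sub>R (LINT u|lebesgue. indicator {0<..<x} (x * u) *\<^sub>R f (x * u))"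
    using lebesgue_integral_real_affine[OF assms, of "\<lambda>t. indicator {0<..<x} t *\<^sub>R f t" 0] True
    by simp
  also have "(\<lambda>u. indicator {0<..<x} (x * u) *\<^sub>R f (x * u)) = (\<lambda>u. indicator {0<..<1} u * f (u * x))"
    using True by (auto simp: fun_eq_iff indicator_def zero_less_mult_iff mult.commute)
  finally show ?thesis
    using True by (simp add: cesaro_fun_def hausdorff_fun_def scaleR_conv_of_real)
next
  case False
  with assms have x: "x < 0" by simp
  have "(LINT t=0..x|lebesgue. f t) = - (LINT t|lebesgue. indicator {x<..<0} t *\<^sub>R f t)"
    using x by (simp add: interval_lebesgue_integral_def set_lebesgue_integral_def zero_ereal_def)
  also have "(LINT t|lebesgue. indicator {x<..<0} t *\<^sub>R f t) =
      (- x) *\<^sub>R (LINT u|lebesgue. indicator {x<..<0} (x * u) *\<^sub>R f (x * u))"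
    using lebesgue_integral_real_affine[OF assms, of "\<lambda>t. indicator {x<..<0} t *\<^sub>R f t" 0] x
    by simp
  also have "(\<lambda>u. indicator {x<..<0} (x * u) *\<^sub>R f (x * u)) = (\<lambda>u. indicator {0<..<1} u * f (u * x))"
    using x by (auto simp: fun_eq_iff indicator_def mult_less_0_iff mult.commute)
  finally show ?thesis
    using x by (simp add: cesaro_fun_def hausdorff_fun_def scaleR_conv_of_real)
qed

lift_definition cesaro :: "l2 \<Rightarrow>\<^sub>L l2" is "\<lambda>f. abs_l2 (cesaro_fun (rep_l2 f))"
proof -
  let ?H = "hausdorff_fun (indicator {0<..<1})"
  have "abs_l2 (cesaro_fun (rep_l2 f)) = abs_l2 (?H (rep_l2 f))" for f
  proof (rule abs_l2_eqI)
    have sq: "sq_integrable (?H (rep_l2 f))"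
      by (rule hausdorff_fun_props(2)[OF hausdorff_kernel_cesaro sq_integrable_rep_l2])
    have ae: "AE x in lebesgue. ?H (rep_l2 f) x = cesaro_fun (rep_l2 f) x"
      using AE_lebesgue_neq[of 0] by eventually_elim (simp add: cesaro_fun_eq_hausdorff)
    have m: "cesaro_fun (rep_l2 f) \<in> borel_measurable lebesgue"
      by (rule borel_measurable_AE[OF _ ae]) (use sq in \<open>simp add: sq_integrable_def\<close>)
    have "integrable lebesgue (\<lambda>x. (cmod (cesaro_fun (rep_l2 f) x))\<^sup>2)"
    proof (rule integrable_cong_AE_imp)
      show "integrable lebesgue (\<lambda>x. (cmod (?H (rep_l2 f) x))\<^sup>2)"
        using sq by (simp add: sq_integrable_def)
      show "(\<lambda>x. (cmod (cesaro_fun (rep_l2 f) x))\<^sup>2) \<in> borel_measurable lebesgue"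
        using m by measurable
      show "AE x in lebesgue. (cmod (?H (rep_l2 f) x))\<^sup>2 = (cmod (cesaro_fun (rep_l2 f) x))\<^sup>2"
        using ae by eventually_elim simp
    qed
    thus "eq_l2 (cesaro_fun (rep_l2 f)) (?H (rep_l2 f))"
      using sq ae m by (auto simp: eq_l2_def sq_integrable_def elim: eventually_mono)
  qed
  thus "bounded_linear (\<lambda>f. abs_l2 (cesaro_fun (rep_l2 f)))"
    using bounded_linear_hausdorff_fun[OF hausdorff_kernel_cesaro] by simp
qed


section \<open>The holomorphic functional calculus\<close>

text \<open>
  The elements of \<open>l2_unit \<Rightarrow>\<^sub>L l2_unit\<close> are only real-linear. For a complex-linear \<open>A\<close>, a two-sided
  inverse of \<open>scalar_op z - A\<close> is automatically complex-linear, so spectrum and resolvent are the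
  usual complex ones.
\<close>

definition is_resolvent :: "(l2_unit \<Rightarrow>\<^sub>L l2_unit) \<Rightarrow> complex \<Rightarrow> (l2_unit \<Rightarrow>\<^sub>L l2_unit) \<Rightarrow> bool" where
  "is_resolvent A z R \<longleftrightarrow>
     (scalar_op z - A) o\<^sub>L R = id_blinfun \<and> R o\<^sub>L (scalar_op z - A) = id_blinfun"

definition spectrum :: "(l2_unit \<Rightarrow>\<^sub>L l2_unit) \<Rightarrow> complex set" where
  "spectrum A = {z. \<nexists>R. is_resolvent A z R}"

definition resolvent :: "(l2_unit \<Rightarrow>\<^sub>L l2_unit) \<Rightarrow> complex \<Rightarrow> l2_unit \<Rightarrow>\<^sub>L l2_unit" where
  "resolvent A z = (THE R. is_resolvent A z R)"

text \<open>
  A single closed path (rather than a cycle) suffices because the only spectrum considered here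
  is a disc.
\<close>

definition surrounds :: "(real \<Rightarrow> complex) \<Rightarrow> complex set \<Rightarrow> complex set \<Rightarrow> bool" where
  "surrounds \<gamma> S U \<longleftrightarrow>
     valid_path \<gamma> \<and> pathfinish \<gamma> = pathstart \<gamma> \<and> path_image \<gamma> \<subseteq> U - S \<and>
     (\<forall>z\<in>S. winding_number \<gamma> z = 1) \<and> (\<forall>z. z \<notin> U \<longrightarrow> winding_number \<gamma> z = 0)"

definition riesz_dunford_integral ::
    "(real \<Rightarrow> complex) \<Rightarrow> (complex \<Rightarrow> complex) \<Rightarrow> (l2_unit \<Rightarrow>\<^sub>L l2_unit) \<Rightarrow> l2_unit \<Rightarrow>\<^sub>L l2_unit" where
  "riesz_dunford_integral \<gamma> F A =
     scalar_op (1 / (2 * of_real pi * \<i>)) o\<^sub>L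
       integral {0..1} (\<lambda>t. scalar_op (F (\<gamma> t) * vector_derivative \<gamma> (at t within {0..1}))
                             o\<^sub>L resolvent A (\<gamma> t))"

text \<open>
  The operator \<open>F(A)\<close> for \<open>F\<close> holomorphic on the open set \<open>U \<supseteq> spectrum A\<close>. By Cauchy's
  theorem the integral does not depend on the surrounding contour that is chosen.
\<close>

definition holomorphic_calculus ::
    "complex set \<Rightarrow> (complex \<Rightarrow> complex) \<Rightarrow> (l2_unit \<Rightarrow>\<^sub>L l2_unit) \<Rightarrow> l2_unit \<Rightarrow>\<^sub>L l2_unit" where
  "holomorphic_calculus U F A =
     riesz_dunford_integral (SOME \<gamma>. surrounds \<gamma> (spectrum A) U) F A"


section \<open>The Mellin transform\<close>

definition mellin :: "(real \<Rightarrow> complex) \<Rightarrow> complex \<Rightarrow> complex" where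
  "mellin K z = (LINT u:{0<..}|lebesgue. K u * of_real u powr (z - 1))"

end

theory Submission
  imports Defs "HOL-Probability.Levy"
begin

text \<open>
  For \<open>Re w < 1/2\<close> let \<open>k\<^sub>w(u) = u\<^sup>-\<^sup>w\<close> on \<open>(0,1)\<close> and \<open>0\<close> elsewhere, and let \<open>B\<^sub>w\<close> be the compression of
  the Hausdorff operator with kernel \<open>k\<^sub>w\<close> to the functions on the unit interval; \<open>B\<^sub>0\<close> is the
  Cesaro operator \<open>C\<close>. On the Mellin side \<open>k\<^sub>w\<close> is \<open>1/(s - w)\<close>, and composition of operators is
  multiplication there, so the partial fraction decomposition of \<open>1/((s - a)(s - b))\<close> predicts
  \<open>B\<^sub>a B\<^sub>b = (B\<^sub>b - B\<^sub>a)/(b - a)\<close>. This is \<open>unit_hausdorff_power_kernel_compose\<close>, proved by Fubini's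
  theorem. With \<open>a = 0\<close> and \<open>b = 1/z\<close> it says that the resolvent of \<open>C\<close> at \<open>z\<close> is
  \<open>1/z + z\<^sup>-\<^sup>2 B\<^bsub>1/z\<^esub>\<close>, valid for \<open>z \<noteq> 0\<close> with \<open>Re (1/z) < 1/2\<close>, that is, outside
  the closed disc. Each \<open>z\<close> in the open disc is an eigenvalue with eigenfunction \<open>k\<^sub>w\<close>,
  \<open>w = 1 - 1/z\<close>, and limits of eigenvalues lie in the spectrum, so the spectrum is exactly the closed
  disc.

  Integrate \<open>F(z)/(2\<pi>\<i>)\<close> times this resolvent over a contour \<open>\<gamma>\<close>. The first summand gives \<open>F(0)\<close> by
  Cauchy's formula, and the second one is the compressed Hausdorff operator with kernel
  \<open>K(u) = (1/2\<pi>\<i>) \<integral>\<^sub>\<gamma> F(z) z\<^sup>-\<^sup>2 k\<^bsub>1/z\<^esub>(u) dz\<close>. Its Mellin transform is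
  \<open>(1/2\<pi>\<i>) \<integral>\<^sub>\<gamma> F(z) (1/(z - 1/s) - 1/z) dz = F(1/s) - F(0)\<close>, again by Cauchy's formula. This is
  \<open>cesaro_calculus\<close>, and it contains the first half of the theorem.

  The calculus integrates an operator-valued function along a contour whose derivative may be
  unbounded, so the existence of the integral is not automatic. It is obtained by integrating the
  kernels instead: after division by a common weight \<open>u\<^bsup>\<delta> - 1/2\<^esup>\<close> and the substitution
  \<open>x = ln u\<close> they depend analytically on \<open>z\<close> in the Banach space of bounded continuous functions, where local primitives exist
  (\<open>bcontfun_contour_integrable\<close>). The passage from a kernel to its operator and the passage to its
  Mellin transform at \<open>s\<close> are bounded linear maps on that space, hence commute with the integral.

  For the converse, a kernel \<open>L\<close> with the three properties differs from \<open>K\<close> by a kernel whose Mellin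
  transform is the constant \<open>F(0)\<close> on the critical line. That transform is the Fourier transform of an
  integrable function in the variable \<open>ln u\<close>, so both the difference and the constant vanish
  (\<open>mellin_constant\<close>), by Levy's uniqueness theorem for characteristic functions.
\<close>

section \<open>Hausdorff operators as functions of their kernel\<close>

lemma hausdorff_abs_l2:
  assumes "hausdorff_kernel K" "sq_integrable f"
  shows "blinfun_apply (hausdorff K) (abs_l2 f) = abs_l2 (hausdorff_fun K f)"
  unfolding hausdorff_apply[OF assms(1)]
proof (rule abs_l2_eqI)
  have eq: "eq_l2 (rep_l2 (abs_l2 f)) f" by (rule eq_l2_rep_abs[OF assms(2)])
  have "AE x in lebesgue. hausdorff_fun K (rep_l2 (abs_l2 f)) x = hausdorff_fun K f x"
    using AE_lebesgue_neq[of 0]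
    by eventually_elim
      (use eq assms(1) in \<open>auto intro!: hausdorff_fun_cong simp: eq_l2_def sq_integrable_def hausdorff_kernel_def\<close>)
  thus "eq_l2 (hausdorff_fun K (rep_l2 (abs_l2 f))) (hausdorff_fun K f)"
    by (simp add: eq_l2_def hausdorff_fun_props(2)[OF assms(1)] assms(2) sq_integrable_rep_l2)
qed

text \<open>
  Borel representatives allow all later integrals to be computed with \<^term>\<open>lborel\<close>, where the
  measurability of functions of two variables, as in Fubini's theorem, is automatic.
\<close>

lemma l2_borel_representative:
  obtains g where "sq_integrable g" "g \<in> borel_measurable borel" "f = abs_l2 g"
proof -
  have "rep_l2 f \<in> borel_measurable lebesgue"
    using sq_integrable_rep_l2[of f] by (simp add: sq_integrable_def)
  then obtain g where g: "g \<in> borel_measurable borel" and ae: "AE x in lebesgue. rep_l2 f x = g x"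
    by (rule ex_borel_representative)
  have gm: "g \<in> borel_measurable lebesgue"
    using g by (intro measurable_completion) simp
  have "integrable lebesgue (\<lambda>x. (cmod (g x))\<^sup>2)"
  proof (rule integrable_cong_AE_imp)
    show "integrable lebesgue (\<lambda>x. (cmod (rep_l2 f x))\<^sup>2)"
      using sq_integrable_rep_l2[of f] by (simp add: sq_integrable_def)
    show "(\<lambda>x. (cmod (g x))\<^sup>2) \<in> borel_measurable lebesgue"
      using gm by measurable
  qed (use ae in \<open>eventually_elim, simp\<close>)
  hence sq: "sq_integrable g" using gm by (simp add: sq_integrable_def)
  have "abs_l2 (rep_l2 f) = abs_l2 g"
    using sq ae by (intro abs_l2_eqI) (simp add: eq_l2_def sq_integrable_rep_l2)
  thus thesis using that sq g by (simp add: abs_rep_l2)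
qed

text \<open>
  Equality of operators on classes reduces to an almost everywhere identity for Borel functions.
\<close>

lemma hausdorff_eqI:
  assumes "hausdorff_kernel K"
    and "\<And>f. sq_integrable f \<Longrightarrow> f \<in> borel_measurable borel \<Longrightarrow> sq_integrable (G f)"
    and "\<And>f. sq_integrable f \<Longrightarrow> f \<in> borel_measurable borel \<Longrightarrow> blinfun_apply A (abs_l2 f) = abs_l2 (G f)"
    and "\<And>f. sq_integrable f \<Longrightarrow> f \<in> borel_measurable borel \<Longrightarrow> AE x in lebesgue. hausdorff_fun K f x = G f x"
  shows "hausdorff K = A"
proof (rule blinfun_eqI)
  fix f :: l2
  obtain g where g: "sq_integrable g" "g \<in> borel_measurable borel" "f = abs_l2 g"
    by (rule l2_borel_representative)
  show "blinfun_apply (hausdorff K) f = blinfun_apply A f"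
    unfolding g(3) hausdorff_abs_l2[OF assms(1) g(1)] assms(3)[OF g(1,2)]
    by (rule abs_l2_eqI)
      (simp add: eq_l2_def assms(2,4) g(1,2) hausdorff_fun_props(2)[OF assms(1) g(1)])
qed

lemma hausdorff_kernel_add:
  assumes "hausdorff_kernel K" "hausdorff_kernel L"
  shows "hausdorff_kernel (\<lambda>u. K u + L u)"
  using assms by (auto simp: hausdorff_kernel_def ring_distribs)

lemma hausdorff_kernel_cmult:
  assumes "hausdorff_kernel K"
  shows "hausdorff_kernel (\<lambda>u. c * K u)"
  using assms by (auto simp: hausdorff_kernel_def mult.assoc)

lemma hausdorff_add:
  assumes "hausdorff_kernel K" "hausdorff_kernel L"
  shows "hausdorff (\<lambda>u. K u + L u) = hausdorff K + hausdorff L"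
proof (rule hausdorff_eqI[where G = "\<lambda>f x. hausdorff_fun K f x + hausdorff_fun L f x"])
  show "hausdorff_kernel (\<lambda>u. K u + L u)" by (rule hausdorff_kernel_add[OF assms])
  fix f assume f: "sq_integrable f"
  show "sq_integrable (\<lambda>x. hausdorff_fun K f x + hausdorff_fun L f x)"
    by (intro sq_integrable_add hausdorff_fun_props(2) assms f)
  show "blinfun_apply (hausdorff K + hausdorff L) (abs_l2 f) =
      abs_l2 (\<lambda>x. hausdorff_fun K f x + hausdorff_fun L f x)"
    using assms f hausdorff_fun_props(2)[OF _ f]
    by (simp add: plus_blinfun.rep_eq hausdorff_abs_l2 plus_l2.abs_eq eq_l2_def)
  show "AE x in lebesgue. hausdorff_fun (\<lambda>u. K u + L u) f x = hausdorff_fun K f x + hausdorff_fun L f x"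
    using hausdorff_fun_props(1)[OF assms(1) f] hausdorff_fun_props(1)[OF assms(2) f]
    by eventually_elim (simp add: hausdorff_fun_def ring_distribs)
qed

lemma hausdorff_cmult_apply:
  assumes "hausdorff_kernel K"
  shows "blinfun_apply (hausdorff (\<lambda>u. c * K u)) f = scaleC_l2 c (blinfun_apply (hausdorff K) f)"
    and "blinfun_apply (hausdorff K) (scaleC_l2 c f) = scaleC_l2 c (blinfun_apply (hausdorff K) f)"
proof -
  obtain g where g: "sq_integrable g" "f = abs_l2 g" by (rule l2_borel_representative)
  have sq: "sq_integrable (hausdorff_fun K g)" by (rule hausdorff_fun_props(2)[OF assms g(1)])
  have "hausdorff_fun (\<lambda>u. c * K u) g = (\<lambda>x. c * hausdorff_fun K g x)"
    "hausdorff_fun K (\<lambda>x. c * g x) = (\<lambda>x. c * hausdorff_fun K g x)"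
    by (auto simp: hausdorff_fun_def mult.assoc mult.left_commute[of _ c])
  thus "blinfun_apply (hausdorff (\<lambda>u. c * K u)) f = scaleC_l2 c (blinfun_apply (hausdorff K) f)"
    and "blinfun_apply (hausdorff K) (scaleC_l2 c f) = scaleC_l2 c (blinfun_apply (hausdorff K) f)"
    using assms g sq
    by (simp_all add: hausdorff_abs_l2 hausdorff_kernel_cmult scaleC_l2.abs_eq eq_l2_def sq_integrable_cmult)
qed

lemma hausdorff_fun_kernel_cong:
  assumes "hausdorff_kernel K" "hausdorff_kernel L" "AE u in lebesgue. K u = L u"
    and "f \<in> borel_measurable lebesgue" "x \<noteq> 0"
  shows "hausdorff_fun K f x = hausdorff_fun L f x"
  unfolding hausdorff_fun_def
proof (rule integral_cong_AE)
  have f: "(\<lambda>u. f (u * x)) \<in> borel_measurable lebesgue"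
    using borel_measurable_affine[OF assms(4,5), of 0] by (simp add: mult.commute)
  show "(\<lambda>u. K u * f (u * x)) \<in> borel_measurable lebesgue" "(\<lambda>u. L u * f (u * x)) \<in> borel_measurable lebesgue"
    using f assms(1,2) by (auto simp: hausdorff_kernel_def)
  show "AE u in lebesgue. K u * f (u * x) = L u * f (u * x)"
    using assms(3) by eventually_elim simp
qed

lemma hausdorff_kernel_cong:
  assumes "hausdorff_kernel K" "hausdorff_kernel L" "AE u in lebesgue. K u = L u"
  shows "hausdorff K = hausdorff L"
proof (rule hausdorff_eqI[OF assms(1), where G = "hausdorff_fun L"])
  fix f assume f: "sq_integrable f"
  show "AE x in lebesgue. hausdorff_fun K f x = hausdorff_fun L f x"
    using AE_lebesgue_neq[of 0]
    by eventually_elim (use f assms in \<open>auto intro!: hausdorff_fun_kernel_cong simp: sq_integrable_def\<close>)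
qed (use hausdorff_fun_props(2)[OF assms(2)] hausdorff_abs_l2[OF assms(2)] in auto)

lemma norm_hausdorff_le:
  assumes K: "hausdorff_kernel K"
  shows "norm (hausdorff K) \<le> (LINT u|lebesgue. cmod (K u * of_real (\<bar>u\<bar> powr (-1/2))))"
    (is "_ \<le> ?W")
proof (rule norm_blinfun_bound)
  fix f :: l2
  obtain g where g: "sq_integrable g" "f = abs_l2 g" by (rule l2_borel_representative)
  have "norm (blinfun_apply (hausdorff K) f) \<le> sqrt (?W\<^sup>2 * (LINT x|lebesgue. (cmod (g x))\<^sup>2))"
    using hausdorff_fun_props(2,3)[OF K g(1)] by (simp add: g hausdorff_abs_l2[OF K] norm_abs_l2)
  also have "\<dots> = ?W * norm f"
    using g by (simp add: norm_abs_l2 real_sqrt_mult)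
  finally show "norm (blinfun_apply (hausdorff K) f) \<le> ?W * norm f" .
qed simp

lemma cesaro_eq_hausdorff: "cesaro = hausdorff (indicator {0<..<1})"
proof -
  have "hausdorff (indicator {0<..<1}) = cesaro"
  proof (rule hausdorff_eqI[OF hausdorff_kernel_cesaro, where G = "hausdorff_fun (indicator {0<..<1})"])
    fix f assume f: "sq_integrable f"
    show sq: "sq_integrable (hausdorff_fun (indicator {0<..<1}) f)"
      by (rule hausdorff_fun_props(2)[OF hausdorff_kernel_cesaro f])
    have sq': "sq_integrable (hausdorff_fun (indicator {0<..<1}) (rep_l2 (abs_l2 f)))"
      by (rule hausdorff_fun_props(2)[OF hausdorff_kernel_cesaro sq_integrable_rep_l2])
    have eq: "eq_l2 (rep_l2 (abs_l2 f)) f" by (rule eq_l2_rep_abs[OF f])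
    have ae: "AE x in lebesgue. hausdorff_fun (indicator {0<..<1}) f x = cesaro_fun (rep_l2 (abs_l2 f)) x"
      using AE_lebesgue_neq[of 0]
    proof eventually_elim
      case (elim x)
      have "hausdorff_fun (indicator {0<..<1}) (rep_l2 (abs_l2 f)) x = hausdorff_fun (indicator {0<..<1}) f x"
        using eq hausdorff_kernel_cesaro elim
        by (intro hausdorff_fun_cong) (auto simp: eq_l2_def sq_integrable_def hausdorff_kernel_def)
      thus ?case by (simp add: cesaro_fun_eq_hausdorff[OF elim])
    qed
    have m: "cesaro_fun (rep_l2 (abs_l2 f)) \<in> borel_measurable lebesgue"
      by (rule borel_measurable_AE[OF _ ae]) (use sq in \<open>simp add: sq_integrable_def\<close>)
    have "integrable lebesgue (\<lambda>x. (cmod (cesaro_fun (rep_l2 (abs_l2 f)) x))\<^sup>2)"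
    proof (rule integrable_cong_AE_imp)
      show "integrable lebesgue (\<lambda>x. (cmod (hausdorff_fun (indicator {0<..<1}) f x))\<^sup>2)"
        using sq by (simp add: sq_integrable_def)
      show "(\<lambda>x. (cmod (cesaro_fun (rep_l2 (abs_l2 f)) x))\<^sup>2) \<in> borel_measurable lebesgue"
        using m by measurable
    qed (use ae in \<open>eventually_elim, simp\<close>)
    thus "blinfun_apply cesaro (abs_l2 f) = abs_l2 (hausdorff_fun (indicator {0<..<1}) f)"
      unfolding cesaro.rep_eq using sq m ae
      by (intro abs_l2_eqI) (auto simp: eq_l2_def sq_integrable_def elim: eventually_mono)
  qed simp
  thus ?thesis by simp
qed

lemma Rep_compression: "Rep_l2_unit (blinfun_apply (compression A) f) = cut_l2 (blinfun_apply A (Rep_l2_unit f))"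
  unfolding compression.rep_eq by (rule Abs_l2_unit_inverse) simp

lemma Rep_scalar_op: "Rep_l2_unit (blinfun_apply (scalar_op c) f) = scaleC_l2 c (Rep_l2_unit f)"
  unfolding scalar_op.rep_eq using Rep_l2_unit[of f] by (intro Abs_l2_unit_inverse) (simp add: cut_scaleC_l2)

lemma l2_unit_op_eqI:
  assumes "\<And>f. Rep_l2_unit (blinfun_apply A f) = Rep_l2_unit (blinfun_apply B f)"
  shows "A = (B :: l2_unit \<Rightarrow>\<^sub>L l2_unit)"
  using assms by (intro blinfun_eqI) (simp add: Rep_l2_unit_inject)

lemma norm_compression_le: "norm (compression A) \<le> norm A"
proof (rule norm_blinfun_bound)
  fix f
  have "norm (blinfun_apply (compression A) f) \<le> norm (blinfun_apply A (Rep_l2_unit f))"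
    by (simp add: norm_l2_unit.rep_eq Rep_compression norm_cut_l2)
  also have "\<dots> \<le> norm A * norm f"
    using norm_blinfun[of A "Rep_l2_unit f"] by (simp add: norm_l2_unit.rep_eq)
  finally show "norm (blinfun_apply (compression A) f) \<le> norm A * norm f" .
qed simp

lemma compression_add: "compression (A + B) = compression A + compression B"
  using linear_add[OF bounded_linear.linear[OF bounded_linear_cut_l2]]
  by (intro l2_unit_op_eqI) (simp add: Rep_compression plus_blinfun.rep_eq plus_l2_unit.rep_eq)

lemma scaleC_l2_add: "scaleC_l2 (c + d) f = scaleC_l2 c f + scaleC_l2 d f"
  by transfer (simp add: eq_l2_def sq_integrable_cmult sq_integrable_add algebra_simps)

lemma scaleC_l2_scaleC: "scaleC_l2 c (scaleC_l2 d f) = scaleC_l2 (c * d) f"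
  by transfer (simp add: eq_l2_def sq_integrable_cmult mult.assoc)

lemma scaleC_l2_of_real: "scaleC_l2 (of_real r) f = r *\<^sub>R f"
  by transfer (simp add: eq_l2_def sq_integrable_cmult scaleR_conv_of_real)

lemma bounded_linear_scalar_op: "bounded_linear scalar_op"
proof (rule bounded_linear_intro)
  show "scalar_op (c + d) = scalar_op c + scalar_op d" for c d
    by (rule l2_unit_op_eqI)
      (simp add: Rep_scalar_op plus_blinfun.rep_eq plus_l2_unit.rep_eq scaleC_l2_add)
  show "scalar_op (r *\<^sub>R c) = r *\<^sub>R scalar_op c" for r c
    by (rule l2_unit_op_eqI)
      (simp add: Rep_scalar_op scaleR_blinfun.rep_eq scaleR_l2_unit.rep_eq scaleR_conv_of_real
         flip: scaleC_l2_scaleC scaleC_l2_of_real)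
  show "norm (scalar_op c) \<le> norm c * 1" for c
    by (rule norm_blinfun_bound) (simp_all add: norm_l2_unit.rep_eq Rep_scalar_op norm_scaleC_l2)
qed

lemma scalar_op_mult: "scalar_op (c * d) = scalar_op c o\<^sub>L scalar_op d"
  by (rule l2_unit_op_eqI) (simp add: Rep_scalar_op scaleC_l2_scaleC)

lemma scalar_op_1: "scalar_op 1 = id_blinfun"
  using scaleC_l2_of_real[of 1] by (intro l2_unit_op_eqI) (simp add: Rep_scalar_op)

abbreviation (input) unit_hausdorff :: "(real \<Rightarrow> complex) \<Rightarrow> l2_unit \<Rightarrow>\<^sub>L l2_unit" where
  "unit_hausdorff K \<equiv> compression (hausdorff K)"

lemma unit_hausdorff_cmult:
  assumes "hausdorff_kernel K"
  shows "unit_hausdorff (\<lambda>u. c * K u) = scalar_op c o\<^sub>L unit_hausdorff K"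
    and "unit_hausdorff K o\<^sub>L scalar_op c = scalar_op c o\<^sub>L unit_hausdorff K"
  by (rule l2_unit_op_eqI;
      simp add: Rep_scalar_op Rep_compression hausdorff_cmult_apply[OF assms] cut_scaleC_l2)+

lemma unit_hausdorff_add:
  assumes "hausdorff_kernel K" "hausdorff_kernel L"
  shows "unit_hausdorff (\<lambda>u. K u + L u) = unit_hausdorff K + unit_hausdorff L"
  by (simp add: hausdorff_add[OF assms] compression_add)

text \<open>
  For a kernel on \<open>(0,1)\<close> the values of \<^term>\<open>hausdorff_fun K f\<close> on \<open>(0,1)\<close> depend only on the values
  of \<open>f\<close> there, so compression is multiplicative on such operators.
\<close>

lemma unit_hausdorff_compose:
  assumes K: "hausdorff_kernel K" and supp: "\<And>u. u \<notin> {0<..<1} \<Longrightarrow> K u = 0"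
  shows "unit_hausdorff K o\<^sub>L compression A = compression (hausdorff K o\<^sub>L A)"
proof -
  have "cut_l2 (blinfun_apply (hausdorff K) (cut_l2 f)) = cut_l2 (blinfun_apply (hausdorff K) f)" for f
  proof -
    obtain g where g: "sq_integrable g" "f = abs_l2 g" by (rule l2_borel_representative)
    let ?c = "\<lambda>g x. indicat_real {0<..<1} x *\<^sub>R (g x :: complex)"
    have sq: "sq_integrable (?c g)" by (rule sq_integrable_cut[OF g(1)])
    have "?c (hausdorff_fun K (?c g)) = ?c (hausdorff_fun K g)"
    proof
      fix x :: real
      have "hausdorff_fun K (?c g) x = hausdorff_fun K g x" if x: "x \<in> {0<..<1}"
        unfolding hausdorff_fun_def
      proof (intro Bochner_Integration.integral_cong refl)
        fix u
        have "u * x < 1" if "u \<in> {0<..<1}"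
          using that x by (simp add: less_1_mult mult_less_cancel_right_disj) (smt (verit) mult_less_cancel_right2)
        thus "K u * ?c g (u * x) = K u * g (u * x)"
          using supp[of u] x by (cases "u \<in> {0<..<1}") (auto simp: indicator_def)
      qed
      thus "?c (hausdorff_fun K (?c g)) x = ?c (hausdorff_fun K g) x" by (auto simp: indicator_def)
    qed
    thus ?thesis
      using g sq hausdorff_fun_props(2)[OF K]
      by (simp add: cut_l2.abs_eq eq_l2_def hausdorff_abs_l2[OF K])
  qed
  thus ?thesis by (intro l2_unit_op_eqI) (simp add: Rep_compression)
qed

section \<open>Composition of Hausdorff operators\<close>

lemma cnorm_hausdorff_kernel:
  assumes "hausdorff_kernel K"
  shows "hausdorff_kernel (\<lambda>u. of_real (cmod (K u)))"
  using assms integrable_norm[of lebesgue "\<lambda>u. K u * of_real (\<bar>u\<bar> powr (-1/2))"]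
    integrable_of_real[of lebesgue "\<lambda>u. cmod (K u) * \<bar>u\<bar> powr (-1/2)"]
  by (auto simp: hausdorff_kernel_def norm_mult)

lemma borel_imp_lebesgue: "f \<in> borel_measurable borel \<Longrightarrow> (f :: real \<Rightarrow> 'b :: topological_space) \<in> borel_measurable lebesgue"
  by (rule measurable_completion) simp

text \<open>
  Substituting \<open>v = r/u\<close> in \<open>\<integral> K(u) \<integral> L(v) f(uvx) dv du\<close> and exchanging the integrals exhibits the
  multiplicative convolution as the kernel of the composition. Fubini's theorem applies for almost
  every \<open>x\<close>, because the operators with kernels \<open>\<bar>K\<bar>\<close> and \<open>\<bar>L\<bar>\<close> applied to \<open>\<bar>f\<bar>\<close> give an almost
  everywhere convergent double integral.
\<close>

lemma hausdorff_compose: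
  fixes K L :: "real \<Rightarrow> complex"
  assumes K: "hausdorff_kernel K" and L: "hausdorff_kernel L" and M: "hausdorff_kernel M"
    and [measurable]: "K \<in> borel_measurable borel" "L \<in> borel_measurable borel" "M \<in> borel_measurable borel"
    and conv: "AE r in lborel. M r = (LINT u|lborel. K u * L (r / u) / of_real \<bar>u\<bar>)"
  shows "hausdorff K o\<^sub>L hausdorff L = hausdorff M"
proof -
  have "hausdorff M = hausdorff K o\<^sub>L hausdorff L"
  proof (rule hausdorff_eqI[OF M, where G = "\<lambda>f. hausdorff_fun K (hausdorff_fun L f)"])
    fix f assume f: "sq_integrable f" and [measurable]: "f \<in> borel_measurable borel"
    note sqL = hausdorff_fun_props(2)[OF L f]
    show "sq_integrable (hausdorff_fun K (hausdorff_fun L f))"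
      by (rule hausdorff_fun_props(2)[OF K sqL])
    show "blinfun_apply (hausdorff K o\<^sub>L hausdorff L) (abs_l2 f) = abs_l2 (hausdorff_fun K (hausdorff_fun L f))"
      by (simp add: hausdorff_abs_l2 K L f sqL)
    let ?K = "\<lambda>u. complex_of_real (cmod (K u))" and ?L = "\<lambda>u. complex_of_real (cmod (L u))"
      and ?f = "\<lambda>u. complex_of_real (cmod (f u))"
    have K': "hausdorff_kernel ?K" and L': "hausdorff_kernel ?L"
      using K L by (auto intro: cnorm_hausdorff_kernel)
    have f': "sq_integrable ?f"
      using f by (auto simp: sq_integrable_def)
    have sqL': "sq_integrable (hausdorff_fun ?L ?f)"
      by (rule hausdorff_fun_props(2)[OF L' f'])
    show "AE x in lebesgue. hausdorff_fun M f x = hausdorff_fun K (hausdorff_fun L f) x"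
      using hausdorff_fun_props(1)[OF K' sqL'] AE_lebesgue_neq[of 0]
    proof eventually_elim
      case (elim x)
      \<comment> \<open>The integrand after the substitution \<open>v = r/u\<close>.\<close>
      define k where "k = (\<lambda>(u, r). K u * L (r / u) / of_real \<bar>u\<bar> * f (r * x))"
      have [measurable]: "k \<in> borel_measurable (lborel \<Otimes>\<^sub>M lborel)"
        unfolding k_def by measurable
      have ne: "AE u :: real in lborel. u \<noteq> 0" by (rule AE_lborel_singleton)
      have subst: "(LINT r|lborel. H (r / u) (r * x)) = \<bar>u\<bar> *\<^sub>R (LINT v|lborel. H v (v * (u * x)))"
        if "u \<noteq> 0" for u and H :: "real \<Rightarrow> real \<Rightarrow> complex"
        using lborel_integral_real_affine[OF that, of "\<lambda>r. H (r / u) (r * x)" 0] that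
        by (simp add: mult_ac)
      have inner: "(LINT r|lborel. k (u, r)) = K u * hausdorff_fun L f (u * x)" if "u \<noteq> 0" for u
      proof -
        have "(LINT r|lborel. k (u, r)) = (K u / of_real \<bar>u\<bar>) * (LINT r|lborel. L (r / u) * f (r * x))"
          unfolding k_def by (subst integral_mult_right_zero[symmetric]) (simp add: mult_ac)
        also have "\<dots> = K u * (LINT v|lborel. L v * f (v * (u * x)))"
          using that by (subst subst[where H = "\<lambda>a b. L a * f b"]) (auto simp: scaleR_conv_of_real)
        also have "(LINT v|lborel. L v * f (v * (u * x))) = hausdorff_fun L f (u * x)"
          unfolding hausdorff_fun_def by (subst integral_completion) auto
        finally show ?thesis .
      qed
      have ninner: "(LINT r|lborel. complex_of_real (norm (k (u, r)))) = ?K u * hausdorff_fun ?L ?f (u * x)" if "u \<noteq> 0" for u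
      proof -
        have "(LINT r|lborel. complex_of_real (norm (k (u, r)))) = (?K u / of_real \<bar>u\<bar>) * (LINT r|lborel. ?L (r / u) * ?f (r * x))"
          unfolding k_def by (subst integral_mult_right_zero[symmetric]) (simp add: norm_mult norm_divide mult_ac)
        also have "\<dots> = ?K u * (LINT v|lborel. ?L v * ?f (v * (u * x)))"
          using that by (subst subst[where H = "\<lambda>a b. ?L a * ?f b"]) (auto simp: scaleR_conv_of_real)
        also have "(LINT v|lborel. ?L v * ?f (v * (u * x))) = hausdorff_fun ?L ?f (u * x)"
          unfolding hausdorff_fun_def by (subst integral_completion) auto
        finally show ?thesis .
      qed
      have int: "integrable (lborel \<Otimes>\<^sub>M lborel) k"
      proof (rule lborel_pair.Fubini_integrable)
        have "integrable lebesgue (\<lambda>u. LINT r|lborel. complex_of_real (norm (k (u, r))))"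
        proof (rule integrable_cong_AE_imp[OF elim(1)])
          show "(\<lambda>u. LINT r|lborel. complex_of_real (norm (k (u, r)))) \<in> borel_measurable lebesgue"
            by (rule borel_imp_lebesgue) measurable
          show "AE u in lebesgue. ?K u * hausdorff_fun ?L ?f (u * x) = (LINT r|lborel. complex_of_real (norm (k (u, r))))"
            using AE_lebesgue_neq[of 0] by eventually_elim (rule ninner[symmetric])
        qed
        hence "integrable lborel (\<lambda>u. LINT r|lborel. complex_of_real (norm (k (u, r))))"
          by (subst (asm) integrable_completion) auto
        thus "integrable lborel (\<lambda>u. LINT r|lborel. norm (k (u, r)))"
          by (simp add: complex_of_real_integrable_eq)
        have "AE u in lebesgue. integrable lebesgue (\<lambda>v. L v * f (v * (u * x)))"
          using AE_lebesgue_scale[OF hausdorff_fun_props(1)[OF L f] elim(2)] .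
        hence "AE u in lborel. integrable lebesgue (\<lambda>v. L v * f (v * (u * x)))"
          by (simp add: AE_completion_iff)
        thus "AE u in lborel. integrable lborel (\<lambda>r. k (u, r))"
          using ne
        proof eventually_elim
          case (elim u)
          have "integrable lborel (\<lambda>v. L v * f (v * (u * x)))"
            using elim(1) by (subst (asm) integrable_completion) auto
          hence "integrable lborel (\<lambda>v. L ((0 + u * v) / u) * f ((0 + u * v) * x))"
            using elim(2) by (simp add: mult_ac)
          hence "integrable lborel (\<lambda>r. L (r / u) * f (r * x))"
            using lborel_integrable_real_affine_iff[OF elim(2), of "\<lambda>r. L (r / u) * f (r * x)" 0] by simp
          hence "integrable lborel (\<lambda>r. (K u / of_real \<bar>u\<bar>) * (L (r / u) * f (r * x)))"
            by (rule integrable_mult_right)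
          thus ?case by (simp add: k_def mult_ac)
        qed
      qed measurable
      have "hausdorff_fun M f x = (LINT r|lborel. M r * f (r * x))"
        unfolding hausdorff_fun_def by (subst integral_completion) auto
      also have "\<dots> = (LINT r|lborel. LINT u|lborel. k (u, r))"
      proof (rule integral_cong_AE)
        show "AE r in lborel. M r * f (r * x) = (LINT u|lborel. k (u, r))"
          using conv by eventually_elim (simp only: k_def prod.case integral_mult_left_zero)
      qed measurable
      also have "\<dots> = (LINT u|lborel. LINT r|lborel. k (u, r))"
        using lborel_pair.Fubini_integral[of "\<lambda>u r. k (u, r)"] int by simp
      also have "\<dots> = (LINT u|lebesgue. LINT r|lborel. k (u, r))"
        by (rule integral_completion[symmetric]) measurable
      also have "\<dots> = hausdorff_fun K (hausdorff_fun L f) x"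
        unfolding hausdorff_fun_def
      proof (rule integral_cong_AE)
        show "(\<lambda>u. LINT r|lborel. k (u, r)) \<in> borel_measurable lebesgue"
          by (rule borel_imp_lebesgue) measurable
        have "hausdorff_fun L f \<in> borel_measurable lebesgue" using sqL by (simp add: sq_integrable_def)
        hence "(\<lambda>u. hausdorff_fun L f (u * x)) \<in> borel_measurable lebesgue"
          using borel_measurable_affine[OF _ elim(2), of "hausdorff_fun L f" 0] by (simp add: mult.commute)
        thus "(\<lambda>u. K u * (LINT v|lebesgue. L v * f (v * (u * x)))) \<in> borel_measurable lebesgue"
          using K by (auto simp: hausdorff_kernel_def hausdorff_fun_def)
        show "AE u in lebesgue. (LINT r|lborel. k (u, r)) = K u * (LINT v|lebesgue. L v * f (v * (u * x)))"
          using AE_lebesgue_neq[of 0] by eventually_elim (simp add: inner hausdorff_fun_def)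
      qed
      finally show ?case .
    qed
  qed
  thus ?thesis by simp
qed

section \<open>Power kernels and the resolvent\<close>

lemma has_integral_powr_complex:
  fixes c :: complex
  assumes "0 < r" "r \<le> 1" "c \<noteq> 0"
  shows "((\<lambda>u. of_real u powr (c - 1)) has_integral (1 - of_real r powr c) / c) {r..1}"
proof -
  have "((\<lambda>u. of_real u powr (c - 1)) has_integral (of_real 1 powr c / c - of_real r powr c / c)) {r..1}"
  proof (rule fundamental_theorem_of_calculus[OF assms(2)])
    fix u assume "u \<in> {r..1}"
    hence u: "u > 0" using assms by auto
    have "((\<lambda>z. z powr c / c) has_field_derivative of_real u powr (c - 1)) (at (of_real u))"
      using u assms by (auto intro!: derivative_eq_intros)
    thus "((\<lambda>u. of_real u powr c / c) has_vector_derivative of_real u powr (c - 1)) (at u within {r..1})"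
      by (intro has_vector_derivative_real_field[unfolded o_def] has_vector_derivative_at_within)
  qed
  thus ?thesis by (simp add: diff_divide_distrib)
qed

lemma integrable_powr_unit:
  fixes c :: complex
  assumes "Re c > 0"
  shows "set_integrable lborel {0<..<1} (\<lambda>u. of_real u powr (c - 1))"
proof -
  have "(\<lambda>u::real. u powr (Re c - 1)) absolutely_integrable_on {0..1}"
    using assms by (intro nonnegative_absolutely_integrable_1 integrable_on_powr_from_0) auto
  hence "(\<lambda>u::real. u powr (Re c - 1)) absolutely_integrable_on {0<..<1}"
    by (rule set_integrable_subset) auto
  hence "integrable lborel (\<lambda>u::real. indicator {0<..<1} u *\<^sub>R u powr (Re c - 1))"
    unfolding set_integrable_def by (subst (asm) integrable_completion) auto
  hence "integrable lborel (\<lambda>u::real. indicator {0<..<1} u *\<^sub>R (of_real u :: complex) powr (c - 1))"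
    by (rule Bochner_Integration.integrable_bound)
      (auto simp: indicator_def norm_powr_real_powr)
  thus ?thesis by (simp add: set_integrable_def)
qed

lemma integral_powr_unit:
  fixes c :: complex
  assumes "Re c > 0"
  shows "(LINT u:{0<..<1}|lborel. of_real u powr (c - 1)) = 1 / c"
proof -
  have deriv: "((\<lambda>u. of_real u powr c / c) has_vector_derivative of_real u powr (c - 1)) (at u)"
    if "u > 0" for u :: real
  proof -
    have "((\<lambda>z. z powr c / c) has_field_derivative of_real u powr (c - 1)) (at (of_real u))"
      using assms that by (auto intro!: derivative_eq_intros)
    thus ?thesis by (rule has_vector_derivative_real_field[unfolded o_def])
  qed
  have "((\<lambda>u::real. of_real u powr (c - 1)) has_integral (of_real 1 powr c / c - of_real 0 powr c / c)) {0..1}"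
  proof (rule fundamental_theorem_of_calculus_interior)
    show "continuous_on {0..1} (\<lambda>u::real. of_real u powr c / c)"
      unfolding continuous_on_eq_continuous_within
    proof
      fix u :: real assume u: "u \<in> {0..1}"
      show "continuous (at u within {0..1}) (\<lambda>u. of_real u powr c / c)"
      proof (cases "u = 0")
        case True
        have "((\<lambda>u::real. u powr Re c) \<longlongrightarrow> 0) (at 0 within {0..1})"
        proof (rule tendsto_zero_powrI)
          show "\<forall>\<^sub>F u in at 0 within {0..1}. (0::real) \<le> u"
            unfolding eventually_at_filter by (rule always_eventually) simp
        qed (use assms in \<open>auto intro: tendsto_ident_at\<close>)
        hence "((\<lambda>u::real. norm ((of_real u :: complex) powr c)) \<longlongrightarrow> 0) (at 0 within {0..1})"
        proof (rule Lim_transform_eventually)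
          show "\<forall>\<^sub>F u in at 0 within {0..1}. u powr Re c = norm ((of_real u :: complex) powr c)"
            unfolding eventually_at_filter by (rule always_eventually) (simp add: norm_powr_real_powr)
        qed
        hence "((\<lambda>u::real. of_real u powr c / c) \<longlongrightarrow> 0 / c) (at 0 within {0..1})"
          using assms by (intro tendsto_divide[OF tendsto_norm_zero_cancel tendsto_const]) auto
        thus ?thesis using True by (simp add: continuous_within)
      next
        case False
        with u have "u > 0" by auto
        hence "isCont (\<lambda>u. of_real u powr c / c) u"
          by (intro has_vector_derivative_continuous[OF deriv])
        thus ?thesis by (rule continuous_at_imp_continuous_within)
      qed
    qed
  qed (use deriv in auto)
  hence "((\<lambda>u::real. of_real u powr (c - 1)) has_integral 1 / c) {0<..<1}"
    by (simp add: has_integral_Icc_iff_Ioo)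
  thus ?thesis
    using set_borel_integral_eq_integral(2)[OF integrable_powr_unit[OF assms]]
    by (simp add: integral_unique)
qed

definition power_kernel :: "complex \<Rightarrow> real \<Rightarrow> complex" where
  "power_kernel w u = indicator {0<..<1} u * of_real u powr (- w)"

lemma borel_measurable_power_kernel [measurable]: "power_kernel w \<in> borel_measurable borel"
  unfolding power_kernel_def by measurable

lemma power_kernel_0: "power_kernel 0 = indicator {0<..<1}"
  by (auto simp: power_kernel_def indicator_def)

lemma power_kernel_outside: "u \<notin> {0<..<1} \<Longrightarrow> power_kernel w u = 0"
  by (simp add: power_kernel_def)

lemma hausdorff_kernel_power_kernel:
  assumes "Re w < 1 / 2"
  shows "hausdorff_kernel (power_kernel w)"
  unfolding hausdorff_kernel_def
proof
  show "power_kernel w \<in> borel_measurable lebesgue" by (rule borel_imp_lebesgue) measurable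
  have "integrable lborel (\<lambda>u. indicator {0<..<1} u *\<^sub>R of_real u powr ((1 / 2 - w) - 1))"
    using integrable_powr_unit[of "1 / 2 - w"] assms by (simp add: set_integrable_def)
  also have "(\<lambda>u. indicator {0<..<1} u *\<^sub>R of_real u powr ((1 / 2 - w) - 1)) =
      (\<lambda>u. power_kernel w u * of_real (\<bar>u\<bar> powr (-1/2)))"
  proof
    fix u :: real
    have "(of_real u :: complex) powr ((1 / 2 - w) - 1) = of_real u powr (- w) * of_real (u powr (-1/2))"
      if "u > 0"
    proof -
      have "(of_real u :: complex) powr ((1 / 2 - w) - 1) = of_real u powr (- w) * of_real u powr (of_real (-1/2))"
        unfolding powr_add[symmetric] by (simp add: algebra_simps)
      thus ?thesis using that powr_of_real[of u "-1/2"] by simp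
    qed
    thus "indicator {0<..<1} u *\<^sub>R of_real u powr ((1 / 2 - w) - 1) =
      power_kernel w u * of_real (\<bar>u\<bar> powr (-1/2))"
      by (auto simp: power_kernel_def indicator_def)
  qed
  finally show "integrable lebesgue (\<lambda>u. power_kernel w u * of_real (\<bar>u\<bar> powr (-1/2)))"
    by (subst integrable_completion) auto
qed

text \<open>
  For \<open>0 < r < 1\<close> the integrand is supported on \<open>(r,1)\<close> and equals \<open>r\<^sup>-\<^sup>b u\<^bsup>b - a - 1\<^esup>\<close> there.
\<close>

lemma integral_power_kernel_convolution:
  assumes "a \<noteq> b"
  shows "(LINT u|lborel. power_kernel a u * power_kernel b (r / u) / of_real \<bar>u\<bar>) =
    (power_kernel b r - power_kernel a r) / (b - a)"
proof (cases "r \<in> {0<..<1}")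
  case False
  have "(\<lambda>u. power_kernel a u * power_kernel b (r / u) / of_real \<bar>u\<bar>) = (\<lambda>u. 0)"
    using False by (auto simp: fun_eq_iff power_kernel_def indicator_def field_simps)
  thus ?thesis using False by (simp add: power_kernel_outside)
next
  case True
  have eq: "power_kernel a u * power_kernel b (r / u) / of_real \<bar>u\<bar> =
      of_real r powr (- b) * (indicator {r<..<1} u *\<^sub>R of_real u powr ((b - a) - 1))" for u
  proof (cases "u \<in> {r<..<1}")
    case u: True
    hence u0: "u > 0" "u < 1" using True by auto
    have "of_real r powr (- b) = (of_real u * of_real (r / u)) powr (- b :: complex)"
      using u0 by simp
    also have "\<dots> = of_real u powr (- b) * of_real (r / u) powr (- b)"
      using u0 True by (intro powr_times_real) auto
    finally have "of_real r powr (- b) * of_real u powr (b - a - 1) =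
        of_real (r / u) powr (- b) * (of_real u powr (- b) * of_real u powr (b - a - 1) :: complex)"
      by simp
    also have "\<dots> = of_real (r / u) powr (- b) * of_real u powr (- a - 1)"
      by (simp add: powr_add[symmetric])
    also have "(of_real u :: complex) powr (- a - 1) = of_real u powr (- a) / of_real u"
      using u0 by (simp add: powr_diff)
    finally show ?thesis using u u0 True by (simp add: power_kernel_def)
  next
    case u: False
    thus ?thesis using True by (auto simp: power_kernel_def indicator_def field_simps)
  qed
  have "set_integrable lborel {r<..<1} (\<lambda>u. of_real u powr ((b - a) - 1))"
  proof (rule set_integrable_subset)
    show "set_integrable lborel {r..1} (\<lambda>u. (of_real u :: complex) powr ((b - a) - 1))"
      using True by (intro borel_integrable_atLeastAtMost' continuous_intros) auto
  qed auto
  note I = set_borel_integral_eq_integral(2)[OF this]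
  have "((\<lambda>u. of_real u powr ((b - a) - 1)) has_integral (1 - of_real r powr (b - a)) / (b - a)) {r<..<1}"
    using has_integral_powr_complex[of r "b - a"] True assms by (simp add: has_integral_Icc_iff_Ioo)
  hence "(LINT u|lborel. power_kernel a u * power_kernel b (r / u) / of_real \<bar>u\<bar>) =
      of_real r powr (- b) * ((1 - of_real r powr (b - a)) / (b - a))"
    unfolding eq integral_mult_right_zero using I by (simp add: integral_unique set_lebesgue_integral_def)
  thus ?thesis using True by (simp add: power_kernel_def right_diff_distrib powr_add[symmetric])
qed

lemma unit_hausdorff_power_kernel_compose:
  assumes a: "Re a < 1 / 2" and b: "Re b < 1 / 2" and "a \<noteq> b"
  shows "unit_hausdorff (power_kernel a) o\<^sub>L unit_hausdorff (power_kernel b) =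
    scalar_op (1 / (b - a)) o\<^sub>L (unit_hausdorff (power_kernel b) - unit_hausdorff (power_kernel a))"
proof -
  note ka = hausdorff_kernel_power_kernel[OF a] and kb = hausdorff_kernel_power_kernel[OF b]
  let ?M = "\<lambda>u. 1 / (b - a) * (power_kernel b u + (- 1) * power_kernel a u)"
  have kM: "hausdorff_kernel ?M"
    by (intro hausdorff_kernel_cmult hausdorff_kernel_add ka kb)
  have "hausdorff (power_kernel a) o\<^sub>L hausdorff (power_kernel b) = hausdorff ?M"
    by (rule hausdorff_compose[OF ka kb kM])
      (auto simp: integral_power_kernel_convolution[OF assms(3)])
  moreover have "unit_hausdorff (power_kernel a) o\<^sub>L unit_hausdorff (power_kernel b) =
      compression (hausdorff (power_kernel a) o\<^sub>L hausdorff (power_kernel b))"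
    by (rule unit_hausdorff_compose[OF ka]) (rule power_kernel_outside)
  ultimately have "unit_hausdorff (power_kernel a) o\<^sub>L unit_hausdorff (power_kernel b) = unit_hausdorff ?M"
    by simp
  also have "\<dots> = scalar_op (1 / (b - a)) o\<^sub>L (unit_hausdorff (power_kernel b) + (scalar_op (-1) o\<^sub>L unit_hausdorff (power_kernel a)))"
    by (simp only: unit_hausdorff_cmult hausdorff_kernel_add hausdorff_kernel_cmult ka kb unit_hausdorff_add)
  also have "scalar_op (-1) o\<^sub>L unit_hausdorff (power_kernel a) = - unit_hausdorff (power_kernel a)"
    using linear_neg[OF bounded_linear.linear[OF bounded_linear_scalar_op], of 1]
    by (intro blinfun_eqI) (simp add: scalar_op_1 blinfun.minus_left)
  finally show ?thesis by simp
qed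

lemma outside_disc_iff: "z \<notin> cball 1 1 \<longleftrightarrow> z \<noteq> 0 \<and> Re (1 / z) < 1 / 2"
proof (cases "z = 0")
  case False
  have "z \<notin> cball 1 1 \<longleftrightarrow> 1 < (cmod (1 - z))\<^sup>2"
    using abs_square_le_1[of "cmod (1 - z)"] by (simp only: mem_cball dist_norm not_le[symmetric] abs_norm_cancel)
  also have "(cmod (1 - z))\<^sup>2 = 1 - 2 * Re z + (cmod z)\<^sup>2"
    unfolding cmod_power2 by (simp add: power2_eq_square algebra_simps)
  also have "1 < 1 - 2 * Re z + (cmod z)\<^sup>2 \<longleftrightarrow> Re (1 / z) < 1 / 2"
    using False by (simp add: Re_divide' field_simps)
  finally show ?thesis using False by simp
qed auto

text \<open>A two-sided inverse is unique, so the definite description in the resolvent is determined.\<close>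

lemma resolvent_eqI:
  assumes "is_resolvent A z R"
  shows "resolvent A z = R"
  unfolding resolvent_def
proof (rule the_equality)
  show "is_resolvent A z R" by (rule assms)
  fix S assume S: "is_resolvent A z S"
  have "S o\<^sub>L id_blinfun = S" by (rule blinfun_eqI) simp
  hence "S = S o\<^sub>L ((scalar_op z - A) o\<^sub>L R)"
    using assms by (simp add: is_resolvent_def)
  also have "\<dots> = (S o\<^sub>L (scalar_op z - A)) o\<^sub>L R"
    by (rule blinfun_eqI) simp
  also have "\<dots> = id_blinfun o\<^sub>L R" using S by (simp add: is_resolvent_def)
  also have "\<dots> = R" by (rule blinfun_eqI) simp
  finally show "S = R" .
qed

text \<open>
  The formula comes from the Mellin side: \<open>1/(z - 1/s) = 1/z + z\<^sup>-\<^sup>2/(s - 1/z)\<close>. The composition rule for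
  power kernels, applied to \<open>(0, 1/z)\<close> and to \<open>(1/z, 0)\<close>, verifies that it is a right and a left
  inverse.
\<close>

lemma is_resolvent_cesaro:
  assumes z: "z \<notin> cball 1 1"
  shows "is_resolvent (compression cesaro) z
    (scalar_op (1 / z) + (scalar_op (1 / z\<^sup>2) o\<^sub>L unit_hausdorff (power_kernel (1 / z))))"
proof -
  have z0: "z \<noteq> 0" and w: "Re (1 / z) < 1 / 2" using z outside_disc_iff by blast+
  define C where "C = unit_hausdorff (power_kernel 0)"
  define B where "B = unit_hausdorff (power_kernel (1 / z))"
  define s where "s = (\<lambda>c. blinfun_apply (scalar_op c))"
  have C: "compression cesaro = C"
    by (simp add: C_def cesaro_eq_hausdorff power_kernel_0)
  have scal: "s c (s d f) = s (c * d) f" for c d f by (simp add: s_def scalar_op_mult)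
  have s1: "s 1 f = f" for f by (simp add: s_def scalar_op_1)
  have Cs: "C (s c f) = s c (C f)" for c f
    unfolding s_def C_def
    using unit_hausdorff_cmult(2)[of "power_kernel 0" c, THEN arg_cong[where f = "\<lambda>A. blinfun_apply A f"]]
    by (simp add: hausdorff_kernel_power_kernel)
  have Bs: "B (s c f) = s c (B f)" for c f
    unfolding s_def B_def
    using unit_hausdorff_cmult(2)[of "power_kernel (1 / z)" c, THEN arg_cong[where f = "\<lambda>A. blinfun_apply A f"]] w
    by (simp add: hausdorff_kernel_power_kernel)
  have sadd: "s c (f + g) = s c f + s c g" "s c (f - g) = s c f - s c g" for c f g
    by (simp_all add: s_def blinfun.add_right blinfun.diff_right)
  have CB: "C (B f) = s z (B f) - s z (C f)" for f
    using unit_hausdorff_power_kernel_compose[of 0 "1 / z", THEN arg_cong[where f = "\<lambda>A. blinfun_apply A f"]] w z0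
    by (simp add: C_def[symmetric] B_def[symmetric] blinfun.diff_left blinfun.diff_right s_def)
  have "1 / (0 - 1 / z) = - z" by simp
  hence "B (C f) = s (- z) (C f - B f)" for f
    using unit_hausdorff_power_kernel_compose[of "1 / z" 0, THEN arg_cong[where f = "\<lambda>A. blinfun_apply A f"]] w z0
    by (simp add: C_def[symmetric] B_def[symmetric] blinfun.diff_left s_def)
  moreover have "s (- z) f = - s z f" for f
    using linear_neg[OF bounded_linear.linear[OF bounded_linear_scalar_op], of z]
    by (simp add: s_def blinfun.minus_left)
  ultimately have BC: "B (C f) = s z (B f) - s z (C f)" for f
    by (simp add: sadd)
  have "z * (1 / z\<^sup>2) = 1 / z" "1 / z\<^sup>2 * z = 1 / z" using z0 by (simp_all add: power2_eq_square)
  note e = this scal sadd Cs Bs CB BC s1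
  have "s z (s (1 / z) f + s (1 / z\<^sup>2) (B f)) - C (s (1 / z) f + s (1 / z\<^sup>2) (B f)) = f" for f
    using z0 by (simp only: blinfun.add_right e) (simp add: s1)
  moreover have "s (1 / z) (s z f - C f) + s (1 / z\<^sup>2) (B (s z f - C f)) = f" for f
    using z0 by (simp only: blinfun.diff_right e) (simp add: s1)
  ultimately show ?thesis
    unfolding is_resolvent_def C B_def[symmetric]
    by (intro conjI blinfun_eqI) (simp_all add: blinfun.add_left blinfun.diff_left s_def)
qed

lemmas resolvent_cesaro = resolvent_eqI[OF is_resolvent_cesaro]

section \<open>The spectrum of the Cesaro operator on the unit interval\<close>

lemma sq_integrable_power_kernel:
  assumes "Re w < 1 / 2"
  shows "sq_integrable (power_kernel w)"
  unfolding sq_integrable_def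
proof
  show "power_kernel w \<in> borel_measurable lebesgue" by (rule borel_imp_lebesgue) measurable
  have "integrable lborel (\<lambda>u. norm (indicator {0<..<1} u *\<^sub>R (of_real u :: complex) powr (of_real (1 - 2 * Re w) - 1)))"
    using integrable_powr_unit[of "of_real (1 - 2 * Re w)"] assms
    by (intro integrable_norm) (simp add: set_integrable_def)
  also have "(\<lambda>u. norm (indicator {0<..<1} u *\<^sub>R (of_real u :: complex) powr (of_real (1 - 2 * Re w) - 1)))
      = (\<lambda>u. (cmod (power_kernel w u))\<^sup>2)"
    by (auto simp: fun_eq_iff power_kernel_def indicator_def norm_powr_real_powr powr_add[symmetric] power2_eq_square)
  finally show "integrable lebesgue (\<lambda>u. (cmod (power_kernel w u))\<^sup>2)"
    by (subst integrable_completion) auto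
qed

lemma power_kernel_nonzero:
  assumes "Re w < 1 / 2"
  shows "abs_l2 (power_kernel w) \<noteq> 0"
proof
  assume "abs_l2 (power_kernel w) = 0"
  hence "(LINT u|lebesgue. (cmod (power_kernel w u))\<^sup>2) = 0"
    using norm_abs_l2[OF sq_integrable_power_kernel[OF assms]] by simp
  hence "AE u in lebesgue. (cmod (power_kernel w u))\<^sup>2 = 0"
    using sq_integrable_power_kernel[OF assms]
    by (subst (asm) integral_nonneg_eq_0_iff_AE) (auto simp: sq_integrable_def)
  hence "AE u :: real in lborel. u \<notin> {0<..<1}"
    unfolding AE_completion_iff by (rule eventually_mono) (auto simp: power_kernel_def)
  hence "emeasure lborel {0<..<1::real} = 0"
    by (subst (asm) AE_iff_measurable[of "{0<..<1}"]) auto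
  thus False by simp
qed

text \<open>
  \<open>C\<close> multiplies the power \<open>x\<^sup>-\<^sup>w\<close> by \<open>1/(1 - w)\<close>, and this power is square integrable on \<open>(0,1)\<close> exactly
  when \<open>Re w < 1/2\<close>, that is, when \<open>1/(1 - w)\<close> lies in the open disc.
\<close>

lemma cesaro_eigenvector:
  assumes z: "z \<in> ball 1 1"
  obtains e where "e \<noteq> 0" "blinfun_apply (compression cesaro) e = blinfun_apply (scalar_op z) e"
proof -
  have z0: "z \<noteq> 0" using z by auto
  define w where "w = 1 - 1 / z"
  have "(cmod (1 - z))\<^sup>2 < 1"
    using z abs_square_less_1[of "cmod (1 - z)"] by (simp add: dist_norm)
  moreover have "(cmod (1 - z))\<^sup>2 = 1 - 2 * Re z + (cmod z)\<^sup>2"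
    unfolding cmod_power2 by (simp add: power2_eq_square algebra_simps)
  ultimately have "Re (1 / z) > 1 / 2"
    using z0 by (simp add: Re_divide' field_simps)
  hence w: "Re w < 1 / 2" by (simp add: w_def)
  have sq: "sq_integrable (power_kernel w)" by (rule sq_integrable_power_kernel[OF w])
  have cut: "indicat_real {0<..<1} u *\<^sub>R power_kernel w u = power_kernel w u" for u
    by (auto simp: power_kernel_def indicator_def)
  have "cut_l2 (abs_l2 (power_kernel w)) = abs_l2 (power_kernel w)"
    using sq by (simp add: cut_l2.abs_eq eq_l2_def cut)
  hence R: "Rep_l2_unit (Abs_l2_unit (abs_l2 (power_kernel w))) = abs_l2 (power_kernel w)"
    by (intro Abs_l2_unit_inverse) simp
  have *: "indicat_real {0<..<1} x *\<^sub>R hausdorff_fun (indicator {0<..<1}) (power_kernel w) x =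
     z * power_kernel w x" for x
  proof (cases "x \<in> {0<..<1}")
    case True
    have "hausdorff_fun (indicator {0<..<1}) (power_kernel w) x =
        (LINT u|lborel. indicator {0<..<1} u * power_kernel w (u * x))"
      unfolding hausdorff_fun_def by (rule integral_completion) measurable
    also have "\<dots> = (LINT u|lborel. power_kernel w x * (indicator {0<..<1} u *\<^sub>R of_real u powr (1 / z - 1)))"
    proof (rule Bochner_Integration.integral_cong[OF refl])
      fix u :: real
      have "u * x \<in> {0<..<1}" if "u \<in> {0<..<1}"
        using that True mult_strict_mono[of u 1 x 1] by auto
      moreover have "of_real (u * x) powr (- w) = of_real u powr (- w) * (of_real x :: complex) powr (- w)"
        if "u \<in> {0<..<1}"
        using that True powr_times_real[of "of_real u" "of_real x" "- w"] by simp
      ultimately show "indicator {0<..<1} u * power_kernel w (u * x) =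
          power_kernel w x * (indicator {0<..<1} u *\<^sub>R of_real u powr (1 / z - 1))"
        using True by (cases "u \<in> {0<..<1}") (auto simp: power_kernel_def w_def mult_ac)
    qed
    also have "\<dots> = power_kernel w x * (1 / (1 / z))"
      unfolding integral_mult_right_zero
      using integral_powr_unit[of "1 / z"] \<open>Re (1 / z) > 1 / 2\<close> by (simp add: set_lebesgue_integral_def)
    finally show ?thesis using True by simp
  qed (simp add: power_kernel_outside)
  have "cut_l2 (blinfun_apply cesaro (abs_l2 (power_kernel w))) = scaleC_l2 z (abs_l2 (power_kernel w))"
    using sq hausdorff_fun_props(2)[OF hausdorff_kernel_cesaro sq] *
    by (simp add: cesaro_eq_hausdorff hausdorff_abs_l2 hausdorff_kernel_cesaro cut_l2.abs_eq scaleC_l2.abs_eq eq_l2_def)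
  hence "blinfun_apply (compression cesaro) (Abs_l2_unit (abs_l2 (power_kernel w))) =
      blinfun_apply (scalar_op z) (Abs_l2_unit (abs_l2 (power_kernel w)))"
    by (simp add: Rep_l2_unit_inject[symmetric] Rep_compression Rep_scalar_op R)
  moreover have "Abs_l2_unit (abs_l2 (power_kernel w)) \<noteq> 0"
    using power_kernel_nonzero[OF w] R by (metis zero_l2_unit.rep_eq)
  ultimately show thesis using that by blast
qed

text \<open>
  Points of the closed disc are limits of eigenvalues. A bounded inverse \<open>R\<close> of \<open>z - C\<close> would satisfy
  \<open>e = R ((z - y) e)\<close> for an eigenvector \<open>e\<close> with eigenvalue \<open>y\<close>, which is impossible as soon as
  \<open>\<bar>z - y\<bar> * norm R < 1\<close>.
\<close>

lemma spectrum_cesaro: "spectrum (compression cesaro) = cball 1 1"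
proof
  show "spectrum (compression cesaro) \<subseteq> cball 1 1"
    using is_resolvent_cesaro by (auto simp: spectrum_def simp del: mem_cball)
  show "cball 1 1 \<subseteq> spectrum (compression cesaro)"
  proof
    fix z :: complex assume "z \<in> cball 1 1"
    have "\<not> is_resolvent (compression cesaro) z R" for R
    proof
      assume R: "is_resolvent (compression cesaro) z R"
      define d where "d = 1 / (norm R + 1)"
      have "norm R + 1 > 0" by (intro add_nonneg_pos) auto
      hence d: "d > 0" "norm R * d < 1" by (simp_all add: d_def)
      have "z \<in> closure (ball 1 1)" using \<open>z \<in> cball 1 1\<close> by simp
      then obtain y where y: "y \<in> ball 1 1" "dist y z < d"
        using d(1) unfolding closure_approachable by blast
      obtain e where e: "e \<noteq> 0" "blinfun_apply (compression cesaro) e = blinfun_apply (scalar_op y) e"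
        by (rule cesaro_eigenvector[OF y(1)])
      have "blinfun_apply (scalar_op z - compression cesaro) e = blinfun_apply (scalar_op (z - y)) e"
        using linear_diff[OF bounded_linear.linear[OF bounded_linear_scalar_op], of z y]
        by (simp add: blinfun.diff_left e(2))
      moreover have "blinfun_apply R (blinfun_apply (scalar_op z - compression cesaro) e) = e"
        using R by (simp add: is_resolvent_def flip: blinfun_apply_blinfun_compose)
      ultimately have "norm e = norm (blinfun_apply R (blinfun_apply (scalar_op (z - y)) e))" by simp
      also have "\<dots> \<le> norm R * norm (blinfun_apply (scalar_op (z - y)) e)" by (rule norm_blinfun)
      also have "norm (blinfun_apply (scalar_op (z - y)) e) = cmod (z - y) * norm e"
        by (simp add: norm_l2_unit.rep_eq Rep_scalar_op norm_scaleC_l2)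
      also have "norm R * (cmod (z - y) * norm e) \<le> norm R * (d * norm e)"
        using y(2) by (intro mult_left_mono mult_right_mono) (auto simp: dist_norm norm_minus_commute)
      also have "\<dots> < 1 * norm e"
        using d(2) e(1) by (subst mult.assoc[symmetric], intro mult_strict_right_mono) auto
      finally show False by simp
    qed
    thus "z \<in> spectrum (compression cesaro)" by (auto simp: spectrum_def)
  qed
qed

section \<open>Contour integrals of families of bounded continuous functions\<close>

instance bcontfun :: (metric_space, banach) banach ..

definition cmult_bcontfun :: "complex \<Rightarrow> ('a::metric_space \<Rightarrow>\<^sub>C complex) \<Rightarrow> 'a \<Rightarrow>\<^sub>C complex"
  where "cmult_bcontfun c f = Bcontfun (\<lambda>x. c * apply_bcontfun f x)"

lemma apply_cmult_bcontfun: "apply_bcontfun (cmult_bcontfun c f) x = c * apply_bcontfun f x"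
proof -
  have "(\<lambda>x. c * apply_bcontfun f x) \<in> bcontfun"
    by (rule bcontfun_normI[where b = "norm c * norm f"])
      (auto intro!: continuous_intros mult_left_mono norm_bounded simp: norm_mult)
  thus ?thesis by (simp add: cmult_bcontfun_def Bcontfun_inverse)
qed

lemma norm_cmult_bcontfun_le: "norm (cmult_bcontfun c f) \<le> norm c * norm f"
  by (rule norm_bound) (simp add: apply_cmult_bcontfun norm_mult mult_left_mono norm_bounded)

lemma bounded_bilinear_cmult_bcontfun: "bounded_bilinear cmult_bcontfun"
proof
  show "\<exists>K. \<forall>c f. norm (cmult_bcontfun c f) \<le> norm c * norm f * K"
    by (rule exI[of _ 1]) (simp add: norm_cmult_bcontfun_le)
qed (auto intro!: bcontfun_eqI simp: apply_cmult_bcontfun algebra_simps)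

interpretation cmult_bcontfun: bounded_bilinear cmult_bcontfun
  by (rule bounded_bilinear_cmult_bcontfun)

lemma bounded_linear_eval_bcontfun: "bounded_linear (\<lambda>f. apply_bcontfun f x)"
  by (rule bounded_linear_intro[where K = 1]) (auto intro: norm_bounded)

text \<open>
  A vector-valued form of the existence of primitives. The candidate is the integral of \<open>p\<close> along the
  segment from a base point. Its increments are integrals along segments because this holds after
  evaluation at each point \<open>x\<close>, by Cauchy's theorem; its derivative is then read off from the
  continuity of \<open>p\<close> in norm.
\<close>

lemma bcontfun_primitive_on_convex:
  fixes p :: "complex \<Rightarrow> 'a::metric_space \<Rightarrow>\<^sub>C complex"
  assumes "convex B" "open B" and cont: "continuous_on B p"
    and hol: "\<And>x. (\<lambda>z. apply_bcontfun (p z) x) holomorphic_on B"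
  obtains P where "\<And>z. z \<in> B \<Longrightarrow> (P has_derivative (\<lambda>h. cmult_bcontfun h (p z))) (at z)"
proof (cases "B = {}")
  case False
  then obtain a where a: "a \<in> B" by blast
  define J where "J = (\<lambda>z z'. integral {0..1} (\<lambda>t. p (linepath z z' t)))"
  define P where "P = (\<lambda>z. cmult_bcontfun (z - a) (J a z))"
  have seg: "linepath z z' t \<in> B" if "z \<in> B" "z' \<in> B" "t \<in> {0..1}" for z z' t
    using that convex_contains_segment[of B] assms(1) linepath_in_path[of t z z'] by blast
  have J: "((\<lambda>t. p (linepath z z' t)) has_integral J z z') {0..1}" if "z \<in> B" "z' \<in> B" for z z'
    unfolding J_def using that
    by (intro integrable_integral integrable_continuous_interval continuous_on_compose2[OF cont])
      (auto intro: seg continuous_on_linepath)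
  have increment: "P z' - P z = cmult_bcontfun (z' - z) (J z z')" if z: "z \<in> B" "z' \<in> B" for z z'
  proof (rule bcontfun_eqI)
    fix x
    obtain g where g: "\<And>z. z \<in> B \<Longrightarrow> (g has_field_derivative apply_bcontfun (p z) x) (at z within B)"
      using holomorphic_convex_primitive'[OF assms(1,2) hol[of x]] by blast
    have *: "apply_bcontfun (J z z') x * (z' - z) = g z' - g z" if z: "z \<in> B" "z' \<in> B" for z z'
    proof -
      have "((\<lambda>t. apply_bcontfun (p (linepath z z' t)) x) has_integral apply_bcontfun (J z z') x) {0..1}"
        using has_integral_linear[OF J[OF z] bounded_linear_eval_bcontfun] by (simp add: o_def)
      hence "((\<lambda>z. apply_bcontfun (p z) x) has_contour_integral (apply_bcontfun (J z z') x * (z' - z))) (linepath z z')"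
        unfolding has_contour_integral_linepath by (rule has_integral_mult_left)
      moreover have "((\<lambda>z. apply_bcontfun (p z) x) has_contour_integral (g z' - g z)) (linepath z z')"
        using contour_integral_primitive[of B g "\<lambda>z. apply_bcontfun (p z) x" "linepath z z'", OF g]
          closed_segment_subset[OF z assms(1)] by simp
      ultimately show ?thesis by (rule has_contour_integral_unique)
    qed
    show "apply_bcontfun (P z' - P z) x = apply_bcontfun (cmult_bcontfun (z' - z) (J z z')) x"
      using *[OF a z(1)] *[OF a z(2)] *[OF z] by (simp add: P_def apply_cmult_bcontfun mult.commute)
  qed
  have "(P has_derivative (\<lambda>h. cmult_bcontfun h (p z))) (at z)" if z: "z \<in> B" for z
    unfolding has_derivative_at_alt
  proof (intro conjI allI impI)
    show "bounded_linear (\<lambda>h. cmult_bcontfun h (p z))" by (rule cmult_bcontfun.bounded_linear_left)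
    fix e :: real assume "e > 0"
    obtain d1 where d1: "d1 > 0" "ball z d1 \<subseteq> B" using assms(2) z open_contains_ball by blast
    obtain d2 where d2: "d2 > 0" "\<And>y. y \<in> B \<Longrightarrow> dist y z < d2 \<Longrightarrow> dist (p y) (p z) < e"
      using cont z \<open>e > 0\<close> unfolding continuous_on_iff by metis
    show "\<exists>d>0. \<forall>y. norm (y - z) < d \<longrightarrow> norm (P y - P z - cmult_bcontfun (y - z) (p z)) \<le> e * norm (y - z)"
    proof (intro exI[of _ "min d1 d2"] conjI allI impI)
      fix y assume y: "norm (y - z) < min d1 d2"
      hence yB: "y \<in> B" using d1(2) by (auto simp: dist_norm norm_minus_commute)
      have "norm (J z y - p z) \<le> e * measure lborel (cbox 0 (1::real))"
      proof (rule has_integral_bound[OF less_imp_le[OF \<open>e > 0\<close>]])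
        show "((\<lambda>t. p (linepath z y t) - p z) has_integral (J z y - p z)) (cbox 0 1)"
          using has_integral_diff[OF J[OF z yB] has_integral_const_real[of "p z" 0 1]] by simp
        fix t :: real assume t: "t \<in> cbox 0 1"
        have "linepath z y t \<in> closed_segment z y" using t by (auto intro: linepath_in_path)
        hence "dist (linepath z y t) z \<le> norm (y - z)"
          using segment_bound1 by (metis dist_norm norm_minus_commute)
        thus "norm (p (linepath z y t) - p z) \<le> e"
          using d2(2)[of "linepath z y t"] seg[OF z yB] t y by (auto simp: dist_norm)
      qed
      hence le: "norm (J z y - p z) \<le> e" by simp
      have "norm (cmult_bcontfun (y - z) (J z y - p z)) \<le> norm (y - z) * norm (J z y - p z)"
        by (rule norm_cmult_bcontfun_le)
      also have "\<dots> \<le> norm (y - z) * e" by (intro mult_left_mono le) auto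
      finally show "norm (P y - P z - cmult_bcontfun (y - z) (p z)) \<le> e * norm (y - z)"
        by (simp add: increment[OF z yB] cmult_bcontfun.diff_right mult.commute)
    qed (use d1 d2 in auto)
  qed
  thus thesis using that by blast
qed (use that in blast)

text \<open>
  The derivative of a valid path is continuous off a finite set but need not be bounded or absolutely
  integrable near it. Therefore integrability is obtained from the fundamental theorem of calculus,
  with the local primitives composed with \<open>\<gamma>\<close>, and not from continuity of the integrand.
\<close>

lemma bcontfun_contour_integrable:
  fixes p :: "complex \<Rightarrow> 'a::metric_space \<Rightarrow>\<^sub>C complex"
  assumes "open V" and cont: "continuous_on V p"
    and hol: "\<And>x. (\<lambda>z. apply_bcontfun (p z) x) holomorphic_on V"
    and \<gamma>: "valid_path \<gamma>" "path_image \<gamma> \<subseteq> V"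
  shows "(\<lambda>t. cmult_bcontfun (vector_derivative \<gamma> (at t within {0..1})) (p (\<gamma> t))) integrable_on {0..1}"
    (is "?f integrable_on _")
proof -
  obtain S where S: "finite S" "\<And>t. t \<in> {0..1} - S \<Longrightarrow> \<gamma> differentiable at t"
    using \<gamma>(1) by (auto simp: valid_path_def piecewise_C1_differentiable_on_def C1_differentiable_on_eq)
  have cg: "continuous_on {0..1} \<gamma>"
    using valid_path_imp_path[OF \<gamma>(1)] by (simp add: path_def)
  have "?f integrable_on cbox 0 1"
  proof (rule integrable_on_little_subintervals, rule ballI)
    fix t :: real assume t: "t \<in> cbox 0 1"
    hence "\<gamma> t \<in> V" using \<gamma>(2) by (auto simp: path_image_def)
    then obtain r where r: "r > 0" "ball (\<gamma> t) r \<subseteq> V" using assms(1) open_contains_ball by blast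
    obtain P where P: "\<And>z. z \<in> ball (\<gamma> t) r \<Longrightarrow> (P has_derivative (\<lambda>h. cmult_bcontfun h (p z))) (at z)"
    proof (rule bcontfun_primitive_on_convex)
      show "continuous_on (ball (\<gamma> t) r) p" by (rule continuous_on_subset[OF cont r(2)])
      show "(\<lambda>z. apply_bcontfun (p z) x) holomorphic_on ball (\<gamma> t) r" for x
        by (rule holomorphic_on_subset[OF hol r(2)])
    qed auto
    obtain d where d: "d > 0" "\<And>s. s \<in> {0..1} \<Longrightarrow> dist s t < d \<Longrightarrow> dist (\<gamma> s) (\<gamma> t) < r"
      using cg t r(1) unfolding continuous_on_iff by (metis box_real(2))
    show "\<exists>d>0. \<forall>u v. t \<in> cbox u v \<and> cbox u v \<subseteq> ball t d \<and> cbox u v \<subseteq> cbox 0 1 \<longrightarrow> ?f integrable_on cbox u v"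
    proof (intro exI[of _ d] conjI allI impI)
      fix u v assume uv: "t \<in> cbox u v \<and> cbox u v \<subseteq> ball t d \<and> cbox u v \<subseteq> cbox 0 1"
      have near: "\<gamma> s \<in> ball (\<gamma> t) r" if "s \<in> {u..v}" for s
      proof -
        have "s \<in> ball t d" "s \<in> {0..1}" using uv that by auto
        thus ?thesis using d(2)[of s] by (simp add: dist_commute)
      qed
      have "(?f has_integral (P \<circ> \<gamma>) v - (P \<circ> \<gamma>) u) {u..v}"
      proof (rule fundamental_theorem_of_calculus_interior_strong[OF S(1)])
        show "u \<le> v" using uv by auto
        show "continuous_on {u..v} (P \<circ> \<gamma>)"
        proof (rule continuous_on_compose)
          show "continuous_on {u..v} \<gamma>" using uv by (intro continuous_on_subset[OF cg]) auto
          show "continuous_on (\<gamma> ` {u..v}) P"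
            using near by (intro has_derivative_continuous_on[where f' = "\<lambda>z h. cmult_bcontfun h (p z)"]
              has_derivative_at_withinI[OF P]) auto
        qed
        fix s assume s: "s \<in> {u<..<v} - S"
        hence s': "s \<in> {u..v}" "s \<in> {0..1}" using uv by auto
        have D: "(\<gamma> has_vector_derivative vector_derivative \<gamma> (at s)) (at s)"
          using S(2)[of s] s s' by (simp add: vector_derivative_works)
        have eq: "vector_derivative \<gamma> (at s within {0..1}) = vector_derivative \<gamma> (at s)"
          using s' by (intro vector_derivative_at_within_ivl[OF D]) auto
        show "((P \<circ> \<gamma>) has_vector_derivative ?f s) (at s)"
          unfolding eq
          by (rule vector_derivative_diff_chain_within[OF D has_derivative_at_withinI[OF P[OF near[OF s'(1)]]]])
      qed
      thus "?f integrable_on cbox u v" by auto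
    qed (rule d(1))
  qed
  thus ?thesis by simp
qed

section \<open>Kernels parametrised by bounded continuous functions\<close>

text \<open>
  Up to \<open>\<delta>\<close>, the weight \<open>u\<^bsup>\<delta> - 1/2\<^esup>\<close> is the most singular power whose product with a bounded function
  is integrable against \<open>u\<^bsup>-1/2\<^esup>\<close>. In the variable \<open>ln u\<close> the remaining factors of the power kernels
  are exponentials, which have continuous bounded extensions to the line.
\<close>

definition log_kernel :: "real \<Rightarrow> (real \<Rightarrow>\<^sub>C complex) \<Rightarrow> real \<Rightarrow> complex" where
  "log_kernel \<delta> \<phi> u = indicator {0<..<1} u * of_real (u powr (\<delta> - 1/2)) * apply_bcontfun \<phi> (ln u)"

lemma borel_measurable_log_kernel [measurable]: "log_kernel \<delta> \<phi> \<in> borel_measurable borel"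
proof -
  have [measurable]: "apply_bcontfun \<phi> \<in> borel_measurable borel"
    by (rule borel_measurable_continuous_onI) simp
  show ?thesis unfolding log_kernel_def by measurable
qed

lemma log_kernel_outside: "u \<notin> {0<..<1} \<Longrightarrow> log_kernel \<delta> \<phi> u = 0"
  by (simp add: log_kernel_def)

lemma log_kernel_linear:
  "log_kernel \<delta> (\<phi> + \<psi>) = (\<lambda>u. log_kernel \<delta> \<phi> u + log_kernel \<delta> \<psi> u)"
  "log_kernel \<delta> (r *\<^sub>R \<phi>) = (\<lambda>u. of_real r * log_kernel \<delta> \<phi> u)"
  "log_kernel \<delta> (cmult_bcontfun c \<phi>) = (\<lambda>u. c * log_kernel \<delta> \<phi> u)"
  by (auto simp: log_kernel_def fun_eq_iff algebra_simps scaleR_conv_of_real apply_cmult_bcontfun)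

lemma integral_weight:
  assumes "\<delta> > 0"
  shows "integrable lborel (\<lambda>u::real. indicator {0<..<1} u * u powr (\<delta> - 1))"
    and "(LINT u|lborel. indicator {0<..<1} u * u powr (\<delta> - 1)) = 1 / \<delta>"
proof -
  have eq: "indicator {0<..<1} u *\<^sub>R of_real u powr (of_real \<delta> - 1) =
      complex_of_real (indicator {0<..<1} u * u powr (\<delta> - 1))" for u :: real
    using powr_of_real[of u "\<delta> - 1"] by (auto simp: indicator_def)
  have "set_integrable lborel {0<..<1} (\<lambda>u. complex_of_real u powr (of_real \<delta> - 1))"
    using assms by (intro integrable_powr_unit) simp
  thus "integrable lborel (\<lambda>u::real. indicator {0<..<1} u * u powr (\<delta> - 1))"
    unfolding set_integrable_def eq complex_of_real_integrable_eq .
  have "(LINT u:{0<..<1}|lborel. complex_of_real u powr (of_real \<delta> - 1)) = 1 / of_real \<delta>"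
    using assms by (intro integral_powr_unit) simp
  hence "complex_of_real (LINT u|lborel. indicator {0<..<1} u * u powr (\<delta> - 1)) = of_real (1 / \<delta>)"
    unfolding set_lebesgue_integral_def eq by (simp only: integral_complex_of_real of_real_divide of_real_1)
  thus "(LINT u|lborel. indicator {0<..<1} u * u powr (\<delta> - 1)) = 1 / \<delta>"
    by (simp only: of_real_eq_iff)
qed

text \<open>
  The multipliers \<open>k\<close> of interest are \<open>\<bar>u\<bar>\<^bsup>-1/2\<^esup>\<close>, which controls the norm of the operator, and
  \<open>u\<^bsup>s - 1\<^esup>\<close> with \<open>Re s = 1/2\<close>, which gives the Mellin transform.
\<close>

lemma log_kernel_integral_bound:
  assumes \<delta>: "\<delta> > 0" and k [measurable]: "k \<in> borel_measurable borel"
    and k_norm: "\<And>u. 0 < u \<Longrightarrow> norm (k u) = u powr (-1/2)"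
  shows "integrable lborel (\<lambda>u. log_kernel \<delta> \<phi> u * k u)"
    and "(LINT u|lborel. norm (log_kernel \<delta> \<phi> u * k u)) \<le> norm \<phi> * (1 / \<delta>)"
proof -
  have bound: "norm (log_kernel \<delta> \<phi> u * k u) \<le> norm \<phi> * (indicator {0<..<1} u * u powr (\<delta> - 1))" for u
  proof (cases "u \<in> {0<..<1}")
    case True
    have "norm (log_kernel \<delta> \<phi> u * k u) = (u powr (\<delta> - 1/2) * u powr (-1/2)) * norm (apply_bcontfun \<phi> (ln u))"
      using True by (simp add: log_kernel_def norm_mult k_norm)
    also have "u powr (\<delta> - 1/2) * u powr (-1/2) = u powr (\<delta> - 1)"
      by (simp add: powr_add[symmetric])
    also have "u powr (\<delta> - 1) * norm (apply_bcontfun \<phi> (ln u)) \<le> u powr (\<delta> - 1) * norm \<phi>"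
      by (intro mult_left_mono norm_bounded) auto
    finally show ?thesis using True by (simp add: mult.commute)
  qed (simp add: log_kernel_def)
  have w: "integrable lborel (\<lambda>u::real. norm \<phi> * (indicator {0<..<1} u * u powr (\<delta> - 1)))"
    using integral_weight(1)[OF \<delta>] by simp
  show int: "integrable lborel (\<lambda>u. log_kernel \<delta> \<phi> u * k u)"
    by (rule Bochner_Integration.integrable_bound[OF w])
      (use bound in \<open>auto intro!: AE_I2 order_trans[OF bound] simp: abs_mult\<close>)
  have "(LINT u|lborel. norm (log_kernel \<delta> \<phi> u * k u)) \<le>
      (LINT u|lborel. norm \<phi> * (indicator {0<..<1} u * u powr (\<delta> - 1)))"
    by (intro integral_mono integrable_norm int w bound)
  also have "\<dots> = norm \<phi> * (1 / \<delta>)"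
    by (simp only: integral_mult_right_zero integral_weight(2)[OF \<delta>])
  finally show "(LINT u|lborel. norm (log_kernel \<delta> \<phi> u * k u)) \<le> norm \<phi> * (1 / \<delta>)" .
qed

lemma hausdorff_kernel_log_kernel:
  assumes "\<delta> > 0"
  shows "hausdorff_kernel (log_kernel \<delta> \<phi>)"
    and "(LINT u|lebesgue. cmod (log_kernel \<delta> \<phi> u * of_real (\<bar>u\<bar> powr (-1/2)))) \<le> norm \<phi> * (1 / \<delta>)"
proof -
  have m: "(\<lambda>u. complex_of_real (\<bar>u\<bar> powr (-1/2))) \<in> borel_measurable borel" by measurable
  have n: "norm (complex_of_real (\<bar>u\<bar> powr (-1/2))) = u powr (-1/2)" if "u > 0" for u :: real
    using that by simp
  note b = log_kernel_integral_bound[OF assms m n, of \<phi>]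
  have "integrable lebesgue (\<lambda>u. log_kernel \<delta> \<phi> u * of_real (\<bar>u\<bar> powr (-1/2)))"
    using b(1) by (subst integrable_completion) auto
  thus "hausdorff_kernel (log_kernel \<delta> \<phi>)"
    unfolding hausdorff_kernel_def by (auto intro: borel_imp_lebesgue)
  show "(LINT u|lebesgue. cmod (log_kernel \<delta> \<phi> u * of_real (\<bar>u\<bar> powr (-1/2)))) \<le> norm \<phi> * (1 / \<delta>)"
    using b(2) by (subst integral_completion) auto
qed

lemma bounded_linear_unit_hausdorff_log_kernel:
  assumes "\<delta> > 0"
  shows "bounded_linear (\<lambda>\<phi>. unit_hausdorff (log_kernel \<delta> \<phi>))"
proof (rule bounded_linear_intro)
  note k = hausdorff_kernel_log_kernel[OF assms]
  show "unit_hausdorff (log_kernel \<delta> (\<phi> + \<psi>)) = unit_hausdorff (log_kernel \<delta> \<phi>) + unit_hausdorff (log_kernel \<delta> \<psi>)"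
    for \<phi> \<psi> by (simp only: log_kernel_linear unit_hausdorff_add k)
  have "scalar_op (of_real r) = r *\<^sub>R id_blinfun" for r
    using linear_scale[OF bounded_linear.linear[OF bounded_linear_scalar_op], of r 1]
    by (simp add: scaleR_conv_of_real scalar_op_1)
  thus "unit_hausdorff (log_kernel \<delta> (r *\<^sub>R \<phi>)) = r *\<^sub>R unit_hausdorff (log_kernel \<delta> \<phi>)" for r \<phi>
    by (simp only: log_kernel_linear unit_hausdorff_cmult k)
      (auto intro!: blinfun_eqI simp: scaleR_blinfun.rep_eq)
  show "norm (unit_hausdorff (log_kernel \<delta> \<phi>)) \<le> norm \<phi> * (1 / \<delta>)" for \<phi>
  proof -
    have "norm (unit_hausdorff (log_kernel \<delta> \<phi>)) \<le> norm (hausdorff (log_kernel \<delta> \<phi>))"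
      by (rule norm_compression_le)
    also have "\<dots> \<le> norm \<phi> * (1 / \<delta>)"
      by (rule order_trans[OF norm_hausdorff_le[OF k(1)] k(2)])
    finally show ?thesis .
  qed
qed

lemma mellin_log_kernel:
  assumes "\<delta> > 0" "Re s = 1/2"
  shows "mellin (log_kernel \<delta> \<phi>) s = (LINT u|lborel. log_kernel \<delta> \<phi> u * of_real u powr (s - 1))"
proof -
  have "mellin (log_kernel \<delta> \<phi>) s = (LINT u|lebesgue. log_kernel \<delta> \<phi> u * of_real u powr (s - 1))"
    unfolding mellin_def set_lebesgue_integral_def
    by (rule Bochner_Integration.integral_cong) (auto simp: log_kernel_def indicator_def)
  also have "\<dots> = (LINT u|lborel. log_kernel \<delta> \<phi> u * of_real u powr (s - 1))"
    by (rule integral_completion) measurable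
  finally show ?thesis .
qed

lemma bounded_linear_mellin_log_kernel:
  assumes \<delta>: "\<delta> > 0" and s: "Re s = 1/2"
  shows "bounded_linear (\<lambda>\<phi>. mellin (log_kernel \<delta> \<phi>) s)"
proof (rule bounded_linear_intro)
  have m: "(\<lambda>u. complex_of_real u powr (s - 1)) \<in> borel_measurable borel" by measurable
  have n: "norm (complex_of_real u powr (s - 1)) = u powr (-1/2)" if "u > 0" for u :: real
  proof -
    have "Re (s - 1) = -1/2" using s by simp
    thus ?thesis using that by (simp add: norm_powr_real_powr del: minus_complex.simps)
  qed
  note int = log_kernel_integral_bound(1)[OF \<delta> m n] and bound = log_kernel_integral_bound(2)[OF \<delta> m n]
  note M = mellin_log_kernel[OF assms]
  show "mellin (log_kernel \<delta> (\<phi> + \<psi>)) s = mellin (log_kernel \<delta> \<phi>) s + mellin (log_kernel \<delta> \<psi>) s" for \<phi> \<psi>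
    unfolding M unfolding log_kernel_linear distrib_right by (rule Bochner_Integration.integral_add[OF int int])
  show "mellin (log_kernel \<delta> (r *\<^sub>R \<phi>)) s = r *\<^sub>R mellin (log_kernel \<delta> \<phi>) s" for r \<phi>
    unfolding M unfolding log_kernel_linear by (simp add: mult.assoc scaleR_conv_of_real)
  show "norm (mellin (log_kernel \<delta> \<phi>) s) \<le> norm \<phi> * (1 / \<delta>)" for \<phi>
    unfolding M by (rule order_trans[OF integral_norm_bound bound])
qed

text \<open>
  Only the values at \<open>x < 0\<close>, that is \<open>u < 1\<close>, matter; the function is continued by the constant \<open>1\<close>
  to keep it bounded on the whole line.
\<close>

definition exp_bcontfun :: "complex \<Rightarrow> real \<Rightarrow>\<^sub>C complex" where
  "exp_bcontfun a = Bcontfun (\<lambda>x. exp (of_real (min x 0) * a))"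

lemma apply_exp_bcontfun:
  assumes "Re a \<ge> 0"
  shows "apply_bcontfun (exp_bcontfun a) x = exp (of_real (min x 0) * a)"
proof -
  have "(\<lambda>x. exp (of_real (min x 0) * a)) \<in> bcontfun"
  proof (rule bcontfun_normI[where b = 1])
    show "continuous_on UNIV (\<lambda>x::real. exp (of_real (min x 0) * a))"
      by (intro continuous_intros)
    show "norm (exp (complex_of_real (min x 0) * a)) \<le> 1" for x :: real
      using assms by (simp add: mult_nonpos_nonneg)
  qed
  thus ?thesis by (simp add: exp_bcontfun_def Bcontfun_inverse)
qed

text \<open>
  On \<open>Re z \<ge> \<delta>\<close> the derivative of \<open>exp (yz)\<close> in \<open>z\<close> is at most \<open>\<bar>y\<bar> exp (-\<bar>y\<bar>\<delta>) \<le> 1/\<delta>\<close> for all \<open>y \<le> 0\<close>.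
  This uniformity in \<open>y\<close> turns pointwise into norm continuity.
\<close>

lemma exp_bcontfun_lipschitz:
  assumes \<delta>: "\<delta> > 0" and a: "Re a \<ge> \<delta>" and b: "Re b \<ge> \<delta>"
  shows "norm (exp_bcontfun a - exp_bcontfun b) \<le> 1 / \<delta> * norm (a - b)"
proof (rule norm_bound)
  fix x :: real
  define y where "y = min x 0"
  have y: "y \<le> 0" by (simp add: y_def)
  have "norm (exp (of_real y * a) - exp (of_real y * b)) \<le> 1 / \<delta> * norm (a - b)"
  proof (rule field_differentiable_bound)
    show "convex {z. Re z \<ge> \<delta>}" by (rule convex_halfspace_Re_ge)
    show "((\<lambda>z. exp (of_real y * z)) has_field_derivative (of_real y * exp (of_real y * z))) (at z within {z. Re z \<ge> \<delta>})" for z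
      by (auto intro!: derivative_eq_intros)
    fix z assume z: "z \<in> {z. Re z \<ge> \<delta>}"
    have "norm (of_real y * exp (of_real y * z)) = - y * exp (y * Re z)"
      using y by (simp add: norm_mult)
    also have "\<dots> \<le> - y * exp (y * \<delta>)"
      using y z by (intro mult_left_mono) (auto intro: mult_left_mono_neg)
    also have "- y * exp (y * \<delta>) \<le> 1 / \<delta>"
    proof -
      have "(- y * \<delta>) * exp (y * \<delta>) \<le> exp (- y * \<delta>) * exp (y * \<delta>)"
        using exp_ge_add_one_self[of "- y * \<delta>"] by (intro mult_right_mono) (linarith, simp)
      also have "\<dots> = 1" by (simp flip: exp_add)
      finally show ?thesis using \<delta> by (simp add: field_simps)
    qed
    finally show "norm (of_real y * exp (of_real y * z)) \<le> 1 / \<delta>" .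
  qed (use a b in auto)
  thus "norm (apply_bcontfun (exp_bcontfun a - exp_bcontfun b) x) \<le> 1 / \<delta> * norm (a - b)"
    using \<delta> a b by (simp add: apply_exp_bcontfun y_def)
qed

lemma log_kernel_exp_bcontfun:
  assumes "Re w \<le> 1/2 - \<delta>"
  shows "log_kernel \<delta> (exp_bcontfun (1/2 - of_real \<delta> - w)) = power_kernel w"
proof
  fix u
  show "log_kernel \<delta> (exp_bcontfun (1/2 - of_real \<delta> - w)) u = power_kernel w u"
  proof (cases "u \<in> {0<..<1}")
    case True
    hence "log_kernel \<delta> (exp_bcontfun (1/2 - of_real \<delta> - w)) u =
        of_real (exp ((\<delta> - 1/2) * ln u)) * exp (of_real (ln u) * (1/2 - of_real \<delta> - w))"
      using assms by (simp add: log_kernel_def apply_exp_bcontfun powr_def)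
    also have "\<dots> = exp (- w * of_real (ln u))"
      unfolding exp_of_real[symmetric] exp_add[symmetric] by (simp add: algebra_simps)
    finally show ?thesis using True by (simp add: power_kernel_def powr_def Ln_of_real)
  qed (simp add: log_kernel_def power_kernel_def)
qed

lemma mellin_power_kernel:
  assumes "Re w < Re s"
  shows "mellin (power_kernel w) s = 1 / (s - w)"
proof -
  have "mellin (power_kernel w) s = (LINT u|lebesgue. indicator {0<..<1} u *\<^sub>R (of_real u powr ((s - w) - 1)))"
    unfolding mellin_def set_lebesgue_integral_def
    by (rule Bochner_Integration.integral_cong)
      (auto simp: power_kernel_def indicator_def powr_add[symmetric] algebra_simps)
  also have "\<dots> = (LINT u|lborel. indicator {0<..<1} u *\<^sub>R (of_real u powr ((s - w) - 1)))"
    by (rule integral_completion) measurable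
  also have "\<dots> = 1 / (s - w)"
    using integral_powr_unit[of "s - w"] assms by (simp add: set_lebesgue_integral_def)
  finally show ?thesis .
qed

section \<open>The functional calculus of the Cesaro operator\<close>

lemma ex_surrounds_unit_disc:
  assumes "open U" "cball 1 1 \<subseteq> U"
  shows "\<exists>\<gamma>. surrounds \<gamma> (cball 1 1) U"
proof -
  obtain e where e: "e > 0" "(\<Union>x\<in>cball 1 1. ball x e) \<subseteq> U"
    using compact_subset_open_imp_ball_epsilon_subset[OF compact_cball assms] by blast
  define r where "r = 1 + e / 2"
  have r: "r > 1" using e by (simp add: r_def)
  have sub: "cball (1::complex) r \<subseteq> U"
  proof
    fix z :: complex assume z: "z \<in> cball 1 r"
    \<comment> \<open>The radial contraction of the larger disc onto the unit disc moves each point by less than \<open>e\<close>.\<close>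
    define x where "x = 1 + (z - 1) /\<^sub>R r"
    have "1 - x = (1 / r) *\<^sub>R (1 - z)" by (simp add: x_def algebra_simps divide_inverse)
    hence "dist 1 x \<le> 1" using z r by (simp add: dist_norm)
    moreover have "z - x = (1 - 1 / r) *\<^sub>R (z - 1)"
      by (simp add: x_def algebra_simps divide_inverse)
    hence "norm (z - x) = (1 - 1 / r) * norm (z - 1)" using r by simp
    moreover have "(1 - 1 / r) * norm (z - 1) \<le> (1 - 1 / r) * r"
      using z r by (intro mult_left_mono) (auto simp: dist_norm norm_minus_commute)
    moreover have "(1 - 1 / r) * r = r - 1" using r by (simp add: field_simps)
    hence "(1 - 1 / r) * r < e" using e(1) r_def by linarith
    ultimately show "z \<in> U" using e(2) by (force simp: dist_norm norm_minus_commute)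
  qed
  have "surrounds (circlepath 1 r) (cball 1 1) U"
    unfolding surrounds_def
  proof (intro conjI allI impI ballI)
    show "path_image (circlepath 1 r) \<subseteq> U - cball 1 1"
      using sub r by (auto simp: path_image_circlepath dist_norm)
    show "winding_number (circlepath 1 r) z = 1" if "z \<in> cball 1 1" for z
      using that r by (intro winding_number_circlepath) (auto simp: dist_norm norm_minus_commute)
    show "winding_number (circlepath 1 r) z = 0" if "z \<notin> U" for z
      using that sub r by (intro winding_number_zero_outside[of _ "cball 1 r"]) (auto simp: path_image_circlepath)
  qed auto
  thus ?thesis by blast
qed

text \<open>
  The contour hidden in the definition of the calculus is an arbitrary admissible one, so everything is
  done for a general closed path in \<open>U - cball 1 1\<close>. By compactness \<open>Re (1/z)\<close> stays below \<open>1/2\<close> by a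
  fixed amount on it, which provides the exponent \<open>\<delta>\<close> of the weight.
\<close>

lemma cesaro_calculus:
  assumes U: "open U" "cball 1 1 \<subseteq> U" and F: "F holomorphic_on U"
  obtains K where "hausdorff_kernel K" "\<And>u. u \<notin> {0<..<1} \<Longrightarrow> K u = 0"
    and "holomorphic_calculus U F (compression cesaro) = scalar_op (F 0) + unit_hausdorff K"
    and "\<And>s. Re s = 1/2 \<Longrightarrow> mellin K s = F (inverse s) - F 0"
proof -
  define \<gamma> where "\<gamma> = (SOME \<gamma>. surrounds \<gamma> (spectrum (compression cesaro)) U)"
  have "surrounds \<gamma> (cball 1 1) U"
    unfolding \<gamma>_def spectrum_cesaro by (rule someI_ex[OF ex_surrounds_unit_disc[OF U]])
  hence \<gamma>: "valid_path \<gamma>" "pathfinish \<gamma> = pathstart \<gamma>" "path_image \<gamma> \<subseteq> U - cball 1 1"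
      "\<And>z. z \<in> cball 1 1 \<Longrightarrow> winding_number \<gamma> z = 1" "\<And>z. z \<notin> U \<Longrightarrow> winding_number \<gamma> z = 0"
    by (auto simp: surrounds_def)
  have path_z: "z \<noteq> 0 \<and> Re (1 / z) < 1/2" if "z \<in> path_image \<gamma>" for z
    using \<gamma>(3) that outside_disc_iff[of z] by blast
  have "compact ((\<lambda>z. Re (1 / z)) ` path_image \<gamma>)"
    using path_z \<gamma>(1) by (intro compact_continuous_image continuous_intros compact_path_image valid_path_imp_path) auto
  then obtain m where m: "m \<in> path_image \<gamma>" "\<And>z. z \<in> path_image \<gamma> \<Longrightarrow> Re (1 / z) \<le> Re (1 / m)"
    using compact_attains_sup[of "(\<lambda>z. Re (1 / z)) ` path_image \<gamma>"] path_image_nonempty[of \<gamma>] by force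
  define \<delta> where "\<delta> = (1/2 - Re (1 / m)) / 4"
  have \<delta>: "\<delta> > 0" using path_z[OF m(1)] by (simp add: \<delta>_def)
  have path_\<delta>: "Re (1 / z) < 1/2 - 2 * \<delta>" if "z \<in> path_image \<gamma>" for z
    using m(2)[OF that] path_z[OF m(1)] by (simp add: \<delta>_def field_simps)
  define V where "V = U \<inter> (- {0} \<inter> (\<lambda>z. Re (1 / z)) -` {..<1/2 - 2 * \<delta>})"
  have V: "open V"
    unfolding V_def using U(1)
    by (intro open_Int continuous_open_preimage continuous_intros) auto
  have \<gamma>V: "path_image \<gamma> \<subseteq> V"
    using \<gamma>(3) path_z path_\<delta> by (auto simp: V_def)
  define a where "a = (\<lambda>z. 1/2 - of_real \<delta> - 1 / z :: complex)"
  have a: "Re (a z) \<ge> \<delta>" "z \<noteq> 0" if "z \<in> V" for z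
    using that by (auto simp: V_def a_def)
  \<comment> \<open>The kernel \<open>F(z) z\<^sup>-\<^sup>2 k\<^bsub>1/z\<^esub>\<close> as a point of the Banach space of bounded continuous functions.\<close>
  define p where "p = (\<lambda>z. cmult_bcontfun (F z / z\<^sup>2) (exp_bcontfun (a z)))"
  have FV: "F holomorphic_on V" by (rule holomorphic_on_subset[OF F]) (auto simp: V_def)
  have holF: "(\<lambda>z. F z / z\<^sup>2) holomorphic_on V" and hola: "a holomorphic_on V"
    unfolding a_def using FV a(2) by (auto intro!: holomorphic_intros)
  have contp: "continuous_on V p"
    unfolding p_def
  proof (rule cmult_bcontfun.continuous_on)
    show "continuous_on V (\<lambda>z. F z / z\<^sup>2)" by (rule holomorphic_on_imp_continuous_on[OF holF])
    have "(1 / \<delta>)-lipschitz_on {z. Re z \<ge> \<delta>} exp_bcontfun"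
      using exp_bcontfun_lipschitz[OF \<delta>] \<delta> by (intro lipschitz_onI) (auto simp: dist_norm)
    hence "continuous_on {z. Re z \<ge> \<delta>} exp_bcontfun" by (rule lipschitz_on_continuous_on)
    thus "continuous_on V (\<lambda>z. exp_bcontfun (a z))"
      by (rule continuous_on_compose2[OF _ holomorphic_on_imp_continuous_on[OF hola]]) (use a in auto)
  qed
  have holp: "(\<lambda>z. apply_bcontfun (p z) x) holomorphic_on V" for x
  proof -
    have "(\<lambda>z. F z / z\<^sup>2 * exp (of_real (min x 0) * a z)) holomorphic_on V"
      by (intro holomorphic_intros holF hola)
    moreover have "F z / z\<^sup>2 * exp (of_real (min x 0) * a z) = apply_bcontfun (p z) x" if "z \<in> V" for z
      using a[OF that] \<delta> by (simp add: p_def apply_cmult_bcontfun apply_exp_bcontfun)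
    ultimately show ?thesis by (subst holomorphic_cong) auto
  qed
  define d where "d = (\<lambda>t. vector_derivative \<gamma> (at t within {0..1}))"
  define I where "I = integral {0..1} (\<lambda>t. cmult_bcontfun (d t) (p (\<gamma> t)))"
  have I: "((\<lambda>t. cmult_bcontfun (d t) (p (\<gamma> t))) has_integral I) {0..1}"
    unfolding I_def d_def
    by (rule integrable_integral[OF bcontfun_contour_integrable[OF V contp holp \<gamma>(1) \<gamma>V]])
  have on_path: "\<gamma> t \<in> V" "\<gamma> t \<notin> cball 1 1" "\<gamma> t \<noteq> 0" "Re (1 / \<gamma> t) \<le> 1/2 - \<delta>" if "t \<in> {0..1}" for t
  proof -
    have *: "\<gamma> t \<in> path_image \<gamma>" using that by (auto simp: path_image_def)
    show "\<gamma> t \<in> V" "\<gamma> t \<notin> cball 1 1" "\<gamma> t \<noteq> 0" using * \<gamma>V \<gamma>(3) path_z by blast+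
    show "Re (1 / \<gamma> t) \<le> 1/2 - \<delta>" using path_\<delta>[OF *] \<delta> by simp
  qed
  have kernel: "log_kernel \<delta> (cmult_bcontfun (d t) (p (\<gamma> t))) = (\<lambda>u. d t * (F (\<gamma> t) / (\<gamma> t)\<^sup>2) * power_kernel (1 / \<gamma> t) u)"
    if "t \<in> {0..1}" for t
    unfolding p_def a_def log_kernel_linear log_kernel_exp_bcontfun[OF on_path(4)[OF that]] by (simp add: mult.assoc)
  \<comment> \<open>Used at \<open>y = 0\<close> and \<open>y = 1/s\<close>, both of which lie in the closed disc.\<close>
  have cauchy: "((\<lambda>t. F (\<gamma> t) / (\<gamma> t - y) * d t) has_integral 2 * pi * \<i> * F y) {0..1}" if "y \<in> cball 1 1" for y
  proof -
    have "((\<lambda>w. F w / (w - y)) has_contour_integral (2 * pi * \<i> * winding_number \<gamma> y * F y)) \<gamma>"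
      using that U \<gamma> by (intro Cauchy_integral_formula_global[OF U(1) F]) auto
    thus ?thesis using \<gamma>(4)[OF that] by (simp add: has_contour_integral_def d_def)
  qed
  have op_integrand: "scalar_op (F (\<gamma> t) * d t) o\<^sub>L resolvent (compression cesaro) (\<gamma> t) =
      scalar_op (F (\<gamma> t) / (\<gamma> t - 0) * d t) + unit_hausdorff (log_kernel \<delta> (cmult_bcontfun (d t) (p (\<gamma> t))))"
    if t: "t \<in> {0..1}" for t
  proof -
    have w: "hausdorff_kernel (power_kernel (1 / \<gamma> t))"
      using on_path(4)[OF t] \<delta> by (intro hausdorff_kernel_power_kernel) simp
    have "scalar_op (F (\<gamma> t) * d t) o\<^sub>L resolvent (compression cesaro) (\<gamma> t) =
        scalar_op (F (\<gamma> t) * d t * (1 / \<gamma> t)) + (scalar_op (F (\<gamma> t) * d t * (1 / (\<gamma> t)\<^sup>2)) o\<^sub>L unit_hausdorff (power_kernel (1 / \<gamma> t)))"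
      unfolding resolvent_cesaro[OF on_path(2)[OF t]] scalar_op_mult
      by (rule blinfun_eqI) (simp add: blinfun.add_left blinfun.add_right)
    thus ?thesis unfolding kernel[OF t] unit_hausdorff_cmult(1)[OF w] by (simp add: mult_ac)
  qed
  have "((\<lambda>t. scalar_op (F (\<gamma> t) / (\<gamma> t - 0) * d t) + unit_hausdorff (log_kernel \<delta> (cmult_bcontfun (d t) (p (\<gamma> t)))))
      has_integral (scalar_op (2 * pi * \<i> * F 0) + unit_hausdorff (log_kernel \<delta> I))) {0..1}"
    using has_integral_linear[OF cauchy[of 0] bounded_linear_scalar_op]
      has_integral_linear[OF I bounded_linear_unit_hausdorff_log_kernel[OF \<delta>]]
    by (intro has_integral_add) (auto simp: o_def)
  hence "((\<lambda>t. scalar_op (F (\<gamma> t) * d t) o\<^sub>L resolvent (compression cesaro) (\<gamma> t))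
      has_integral (scalar_op (2 * pi * \<i> * F 0) + unit_hausdorff (log_kernel \<delta> I))) {0..1}"
    by (rule has_integral_eq[rotated]) (simp only: op_integrand)
  note op_integral = integral_unique[OF this[unfolded d_def]]
  have "holomorphic_calculus U F (compression cesaro) =
      scalar_op (1 / (2 * of_real pi * \<i>)) o\<^sub>L (scalar_op (2 * pi * \<i> * F 0) + unit_hausdorff (log_kernel \<delta> I))"
    unfolding holomorphic_calculus_def riesz_dunford_integral_def \<gamma>_def[symmetric] op_integral ..
  also have "\<dots> = scalar_op (1 / (2 * of_real pi * \<i>) * (2 * pi * \<i> * F 0)) +
      (scalar_op (1 / (2 * of_real pi * \<i>)) o\<^sub>L unit_hausdorff (log_kernel \<delta> I))"
    unfolding scalar_op_mult by (rule blinfun_eqI) (simp add: blinfun.add_left blinfun.add_right)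
  also have "1 / (2 * of_real pi * \<i>) * (2 * pi * \<i> * F 0) = F 0" by simp
  also have "scalar_op (1 / (2 * of_real pi * \<i>)) o\<^sub>L unit_hausdorff (log_kernel \<delta> I) =
      unit_hausdorff (log_kernel \<delta> (cmult_bcontfun (1 / (2 * of_real pi * \<i>)) I))"
    by (simp only: log_kernel_linear unit_hausdorff_cmult hausdorff_kernel_log_kernel[OF \<delta>])
  finally have calc: "holomorphic_calculus U F (compression cesaro) =
      scalar_op (F 0) + unit_hausdorff (log_kernel \<delta> (cmult_bcontfun (1 / (2 * of_real pi * \<i>)) I))" .
  have "mellin (log_kernel \<delta> (cmult_bcontfun (1 / (2 * of_real pi * \<i>)) I)) s = F (inverse s) - F 0"
    if s: "Re s = 1/2" for s
  proof -
    have s0: "s \<noteq> 0" using s by auto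
    have sd: "inverse s \<in> cball 1 1" using outside_disc_iff[of "inverse s"] s by (auto simp: inverse_eq_divide)
    have "((\<lambda>t. mellin (log_kernel \<delta> (cmult_bcontfun (d t) (p (\<gamma> t)))) s) has_integral mellin (log_kernel \<delta> I) s) {0..1}"
      using has_integral_linear[OF I bounded_linear_mellin_log_kernel[OF \<delta> s]] by (simp add: o_def)
    moreover have "((\<lambda>t. F (\<gamma> t) / (\<gamma> t - inverse s) * d t - F (\<gamma> t) / (\<gamma> t - 0) * d t) has_integral
        (2 * pi * \<i> * F (inverse s) - 2 * pi * \<i> * F 0)) {0..1}"
      by (intro has_integral_diff cauchy sd) simp
    moreover have "F (\<gamma> t) / (\<gamma> t - inverse s) * d t - F (\<gamma> t) / (\<gamma> t - 0) * d t =
        mellin (log_kernel \<delta> (cmult_bcontfun (d t) (p (\<gamma> t)))) s" if t: "t \<in> {0..1}" for t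
    proof -
      have ne: "\<gamma> t \<noteq> inverse s" using on_path(2)[OF t] sd by metis
      have "mellin (log_kernel \<delta> (cmult_bcontfun (d t) (p (\<gamma> t)))) s =
          d t * (F (\<gamma> t) / (\<gamma> t)\<^sup>2) * mellin (power_kernel (1 / \<gamma> t)) s"
        unfolding kernel[OF t] mellin_def set_lebesgue_integral_def
        by (subst integral_mult_right_zero[symmetric]) (simp add: mult_ac scaleR_conv_of_real)
      also have "mellin (power_kernel (1 / \<gamma> t)) s = 1 / (s - 1 / \<gamma> t)"
        using on_path(4)[OF t] s \<delta> by (intro mellin_power_kernel) simp
      also have "d t * (F (\<gamma> t) / (\<gamma> t)\<^sup>2) * (1 / (s - 1 / \<gamma> t)) =
          F (\<gamma> t) / (\<gamma> t - inverse s) * d t - F (\<gamma> t) / (\<gamma> t - 0) * d t"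
      proof -
        have "s * \<gamma> t - 1 \<noteq> 0" using ne s0 by (auto simp: field_simps)
        moreover have "s - 1 / \<gamma> t = (s * \<gamma> t - 1) / \<gamma> t" "\<gamma> t - inverse s = (s * \<gamma> t - 1) / s"
          using s0 on_path(3)[OF t] by (auto simp: field_simps)
        ultimately show ?thesis using s0 on_path(3)[OF t] by (simp add: divide_simps power2_eq_square) algebra
      qed
      finally show ?thesis by simp
    qed
    ultimately have "mellin (log_kernel \<delta> I) s = 2 * pi * \<i> * F (inverse s) - 2 * pi * \<i> * F 0"
      by (metis (no_types, lifting) has_integral_eq has_integral_unique)
    moreover have "mellin (log_kernel \<delta> (cmult_bcontfun (1 / (2 * of_real pi * \<i>)) I)) s =
        1 / (2 * of_real pi * \<i>) * mellin (log_kernel \<delta> I) s"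
      unfolding log_kernel_linear mellin_def set_lebesgue_integral_def
      by (subst integral_mult_right_zero[symmetric]) (simp add: mult_ac scaleR_conv_of_real)
    ultimately show ?thesis by (simp only: right_diff_distrib) simp
  qed
  thus thesis
    using that[OF hausdorff_kernel_log_kernel(1)[OF \<delta>] log_kernel_outside calc] by blast
qed

section \<open>Uniqueness for the Mellin transform on the critical line\<close>

text \<open>
  The positive and the negative part of \<open>g\<close> have equal mass, so if \<open>g\<close> is not zero they can be
  normalised to two probability densities. The images of these under \<open>ln\<close> have the same
  characteristic function, hence coincide by Levy's theorem, and \<open>exp\<close> transports this back to the
  half-line. But the two densities live on disjoint sets.
\<close>

lemma log_fourier_unique_real:
  fixes g :: "real \<Rightarrow> real"
  assumes g: "integrable lborel g" and supp: "\<And>u. u \<le> 0 \<Longrightarrow> g u = 0"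
    and zero: "\<And>t. (LINT u|lborel. g u *\<^sub>R iexp (t * ln u)) = 0"
  shows "AE u in lborel. g u = 0"
proof -
  have gm [measurable]: "g \<in> borel_measurable borel" using borel_measurable_integrable[OF g] by simp
  define m where "m = (LINT u|lborel. \<bar>g u\<bar>)"
  have m0: "m \<ge> 0" by (simp add: m_def)
  have "m = 0"
  proof (rule ccontr)
    assume "m \<noteq> 0"
    with m0 have m: "m > 0" by simp
    \<comment> \<open>Both parts have mass \<open>m/2\<close>, hence the factor \<open>2/m\<close>.\<close>
    define part where "part = (\<lambda>s u. max 0 (s * g u) * (2 / m))"
    have part_m [measurable]: "part s \<in> borel_measurable borel" for s unfolding part_def by measurable
    have part_int: "integrable lborel (part s)" if "\<bar>s\<bar> = 1" for s
    proof (rule Bochner_Integration.integrable_bound)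
      show "integrable lborel (\<lambda>u. g u * (2 / m))" using g by simp
      have "max 0 (s * g u) \<le> \<bar>g u\<bar>" for u
        using that abs_ge_self[of "s * g u"] by (simp add: abs_mult)
      hence "max 0 (s * g u) * (2 / m) \<le> \<bar>g u\<bar> * (2 / m)" for u
        using m by (intro mult_right_mono) auto
      thus "AE u in lborel. norm (part s u) \<le> norm (g u * (2 / m))"
        using m by (intro AE_I2) (simp only: part_def real_norm_def abs_mult abs_of_nonneg max.cobounded1 divide_nonneg_pos zero_le_numeral)
    qed measurable
    have part0: "part s u \<ge> 0" for s u using m by (simp add: part_def)
    have part_diff: "part 1 u - part (-1) u = g u * (2 / m)" "part 1 u + part (-1) u = \<bar>g u\<bar> * (2 / m)" for u
      by (auto simp: part_def max_def algebra_simps)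
    have "(LINT u|lborel. g u) = 0"
    proof -
      have "complex_of_real (LINT u|lborel. g u) = (LINT u|lborel. g u *\<^sub>R iexp (0 * ln u))"
        by (simp add: scaleR_conv_of_real)
      thus ?thesis using zero[of 0] by simp
    qed
    hence diff: "(LINT u|lborel. part 1 u) - (LINT u|lborel. part (-1) u) = 0"
      by (subst Bochner_Integration.integral_diff[symmetric]) (simp_all add: part_int part_diff)
    have "(LINT u|lborel. part 1 u) + (LINT u|lborel. part (-1) u) = 2"
      using m by (subst Bochner_Integration.integral_add[symmetric]) (simp_all add: part_int part_diff m_def[symmetric])
    with diff have mass: "(LINT u|lborel. part s u) = 1" if "s = 1 \<or> s = -1" for s
      using that by auto
    define \<mu> where "\<mu> = (\<lambda>s. density lborel (\<lambda>u. ennreal (part s u)))"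
    have prob: "prob_space (\<mu> s)" if "s = 1 \<or> s = -1" for s
    proof
      have "emeasure (\<mu> s) (space (\<mu> s)) = (\<integral>\<^sup>+u. ennreal (part s u) \<partial>lborel)"
        by (simp add: \<mu>_def emeasure_density)
      also have "\<dots> = 1" using that mass[OF that] part_int[of s] part0
        by (subst nn_integral_eq_integral) auto
      finally show "emeasure (\<mu> s) (space (\<mu> s)) = 1" .
    qed
    have char: "char (distr (\<mu> s) borel ln) t = (LINT u|lborel. part s u *\<^sub>R iexp (t * ln u))" for s t
      unfolding char_def \<mu>_def by (subst integral_distr, simp, simp, subst integral_density) (auto simp: part0)
    have "distr (\<mu> 1) borel ln = distr (\<mu> (-1)) borel ln"
    proof (rule Levy_uniqueness)
      show "char (distr (\<mu> 1) borel ln) = char (distr (\<mu> (-1)) borel ln)"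
      proof
        fix t
        have int: "integrable lborel (\<lambda>u. part s u *\<^sub>R iexp (t * ln u))" if "s = 1 \<or> s = -1" for s
        proof (rule Bochner_Integration.integrable_bound)
          show "integrable lborel (part s)" using that by (intro part_int) auto
        qed (auto simp: part0)
        have "char (distr (\<mu> 1) borel ln) t - char (distr (\<mu> (-1)) borel ln) t =
            (LINT u|lborel. (g u * (2 / m)) *\<^sub>R iexp (t * ln u))"
          unfolding char by (subst Bochner_Integration.integral_diff[symmetric])
            (simp_all only: int scaleR_left_diff_distrib[symmetric] part_diff simp_thms)
        also have "\<dots> = (2 / m) *\<^sub>R (LINT u|lborel. g u *\<^sub>R iexp (t * ln u))"
          by (subst integral_scaleR_right[symmetric]) (simp add: mult.commute)
        finally show "char (distr (\<mu> 1) borel ln) t = char (distr (\<mu> (-1)) borel ln) t"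
          by (simp only: zero) simp
      qed
    qed (use prob[of 1] prob[of "-1"] in \<open>auto intro!: prob_space.real_distribution_distr simp: \<mu>_def\<close>)
    moreover have "distr (distr (\<mu> s) borel ln) borel exp = \<mu> s" for s
    proof -
      have "distr (distr (\<mu> s) borel ln) borel exp = distr (\<mu> s) borel (exp \<circ> ln)"
        by (rule distr_distr) (auto simp: \<mu>_def)
      also have "\<dots> = distr (\<mu> s) borel (\<lambda>u. u)"
      proof (rule distr_cong_AE)
        show "AE u in \<mu> s. (exp \<circ> ln) u = u"
          unfolding \<mu>_def
        proof (subst AE_density, simp, rule AE_I2, rule impI)
          fix u assume "0 < ennreal (part s u)"
          hence "g u \<noteq> 0" by (auto simp: part_def)
          hence "u > 0" using supp[of u] by force
          thus "(exp \<circ> ln) u = u" by simp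
        qed
      qed (auto simp: \<mu>_def)
      also have "\<dots> = \<mu> s" by (rule distr_id2) (simp add: \<mu>_def)
      finally show ?thesis .
    qed
    ultimately have eq: "\<mu> 1 = \<mu> (-1)" by metis
    have "emeasure (\<mu> 1) {u. g u \<le> 0} = 0" "emeasure (\<mu> (-1)) {u. g u > 0} = 0"
      unfolding \<mu>_def by (subst emeasure_density; force simp: part_def indicator_def max_def nn_integral_0_iff_AE)+
    hence "emeasure (\<mu> 1) ({u. g u \<le> 0} \<union> {u. g u > 0}) = 0"
      using eq emeasure_subadditive[of "{u. g u \<le> 0}" "\<mu> 1" "{u. g u > 0}"] by (simp add: \<mu>_def)
    moreover have "{u. g u \<le> 0} \<union> {u. g u > 0} = space (\<mu> 1)" by (auto simp: \<mu>_def)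
    ultimately show False using prob_space.emeasure_space_1[OF prob[of 1]] by simp
  qed
  thus ?thesis
    using g by (simp add: m_def integral_nonneg_eq_0_iff_AE)
qed

lemma log_fourier_unique:
  fixes g :: "real \<Rightarrow> complex"
  assumes g: "integrable lborel g" and supp: "\<And>u. u \<le> 0 \<Longrightarrow> g u = 0"
    and zero: "\<And>t. (LINT u|lborel. g u * iexp (t * ln u)) = 0"
  shows "AE u in lborel. g u = 0"
proof -
  have int: "integrable lborel (\<lambda>u. h u * iexp (t * ln u))" if "integrable lborel h" for h t
  proof (rule Bochner_Integration.integrable_bound[OF that])
    show "(\<lambda>u. h u * iexp (t * ln u)) \<in> borel_measurable lborel"
      using borel_measurable_integrable[OF that] by measurable
  qed (simp add: norm_mult)
  have gc: "integrable lborel (\<lambda>u. cnj (g u))" using g by simp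
  have zero': "(LINT u|lborel. cnj (g u) * iexp (t * ln u)) = 0" for t
  proof -
    have "(LINT u|lborel. cnj (g u) * iexp (t * ln u)) = (LINT u|lborel. cnj (g u * iexp ((- t) * ln u)))"
      by (rule Bochner_Integration.integral_cong) (auto simp: exp_cnj)
    also have "\<dots> = 0" by (simp only: Bochner_Integration.integral_cnj zero complex_cnj_zero)
    finally show ?thesis .
  qed
  have "AE u in lborel. Re (g u) = 0"
  proof (rule log_fourier_unique_real)
    fix t
    have "(LINT u|lborel. Re (g u) *\<^sub>R iexp (t * ln u)) =
        (LINT u|lborel. 1/2 * (g u * iexp (t * ln u) + cnj (g u) * iexp (t * ln u)))"
      by (rule Bochner_Integration.integral_cong)
        (simp_all add: ring_distribs[symmetric] complex_add_cnj scaleR_conv_of_real)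
    also have "\<dots> = 1/2 * ((LINT u|lborel. g u * iexp (t * ln u)) + (LINT u|lborel. cnj (g u) * iexp (t * ln u)))"
      by (simp only: integral_mult_right_zero Bochner_Integration.integral_add[OF int[OF g] int[OF gc]])
    finally show "(LINT u|lborel. Re (g u) *\<^sub>R iexp (t * ln u)) = 0" by (simp only: zero zero') simp
  qed (use g supp in auto)
  moreover have "AE u in lborel. Im (g u) = 0"
  proof (rule log_fourier_unique_real)
    fix t
    have "(LINT u|lborel. Im (g u) *\<^sub>R iexp (t * ln u)) =
        (LINT u|lborel. - \<i>/2 * (g u * iexp (t * ln u) - cnj (g u) * iexp (t * ln u)))"
      by (rule Bochner_Integration.integral_cong) (auto simp: complex_eq_iff field_simps)
    also have "\<dots> = - \<i>/2 * ((LINT u|lborel. g u * iexp (t * ln u)) - (LINT u|lborel. cnj (g u) * iexp (t * ln u)))"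
      by (simp only: integral_mult_right_zero Bochner_Integration.integral_diff[OF int[OF g] int[OF gc]])
    finally show "(LINT u|lborel. Im (g u) *\<^sub>R iexp (t * ln u)) = 0" by (simp only: zero zero') simp
  qed (use g supp in auto)
  ultimately show ?thesis by eventually_elim (simp add: complex_eq_iff)
qed

text \<open>
  A constant transform is unchanged by the shift \<open>t \<mapsto> t + 1\<close>, so \<open>g(u) (u\<^sup>\<i> - 1)\<close> has transform \<open>0\<close> and
  vanishes almost everywhere. As \<open>u\<^sup>\<i> = 1\<close> only for countably many \<open>u\<close>, so does \<open>g\<close>.
\<close>

lemma log_fourier_constant:
  fixes g :: "real \<Rightarrow> complex"
  assumes g: "integrable lborel g" and supp: "\<And>u. u \<le> 0 \<Longrightarrow> g u = 0"
    and const: "\<And>t. (LINT u|lborel. g u * iexp (t * ln u)) = c"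
  shows "c = 0" and "AE u in lborel. g u = 0"
proof -
  have int: "integrable lborel (\<lambda>u. g u * iexp (t * ln u))" for t
  proof (rule Bochner_Integration.integrable_bound[OF g])
    show "(\<lambda>u. g u * iexp (t * ln u)) \<in> borel_measurable lborel"
      using borel_measurable_integrable[OF g] by measurable
  qed (simp add: norm_mult)
  have "AE u in lborel. g u * iexp (1 * ln u) - g u = 0"
  proof (rule log_fourier_unique)
    show "integrable lborel (\<lambda>u. g u * iexp (1 * ln u) - g u)" using int[of 1] g by simp
    fix t
    have "(LINT u|lborel. (g u * iexp (1 * ln u) - g u) * iexp (t * ln u)) =
        (LINT u|lborel. g u * iexp ((t + 1) * ln u) - g u * iexp (t * ln u))"
      by (rule Bochner_Integration.integral_cong) (simp_all add: algebra_simps exp_add)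
    also have "\<dots> = 0" by (simp only: Bochner_Integration.integral_diff[OF int int] const) simp
    finally show "(LINT u|lborel. (g u * iexp (1 * ln u) - g u) * iexp (t * ln u)) = 0" .
  qed (use supp in auto)
  moreover have "AE u in lborel. u \<notin> range (\<lambda>k::int. exp (2 * pi * of_int k))"
    by (rule AE_not_in) (intro countable_imp_null_set_lborel countable_image, simp)
  ultimately show ae: "AE u in lborel. g u = 0"
  proof eventually_elim
    case (elim u)
    show ?case
    proof (rule ccontr)
      assume nz: "g u \<noteq> 0"
      hence "u > 0" using supp[of u] by force
      have "iexp (ln u) = 1" using elim(1) nz by simp
      then obtain k :: int where "ln u = of_int (2 * k) * pi" by (auto simp: exp_eq_1)
      hence "u = exp (2 * pi * of_int k)" using \<open>u > 0\<close> by (metis exp_ln mult.commute mult.assoc of_int_mult of_int_numeral)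
      thus False using elim(2) by blast
    qed
  qed
  have "(LINT u|lborel. g u * iexp (0 * ln u)) = (LINT u::real|lborel. 0)"
    using ae borel_measurable_integrable[OF g] by (intro integral_cong_AE) auto
  thus "c = 0" using const[of 0] by simp
qed

text \<open>
  On the critical line \<open>u\<^bsup>s - 1\<^esup> = u\<^bsup>-1/2\<^esup> exp (\<i>t ln u)\<close> with \<open>t = Im s\<close>, so the Mellin transform of \<open>D\<close> is
  the Fourier transform of \<open>D(u) u\<^bsup>-1/2\<^esup>\<close> in the variable \<open>ln u\<close>.
\<close>

lemma mellin_constant:
  assumes D: "D \<in> borel_measurable lebesgue"
    and int: "set_integrable lebesgue {0<..} (\<lambda>u. D u * of_real (u powr (-1/2)))"
    and const: "\<And>z. Re z = 1/2 \<Longrightarrow> mellin D z = c"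
  shows "c = 0" and "AE u in lebesgue. 0 < u \<longrightarrow> D u = 0"
proof -
  define G where "G = (\<lambda>u. indicator {0<..} u *\<^sub>R (D u * of_real (u powr (-1/2))))"
  have G: "integrable lebesgue G" using int by (simp add: G_def set_integrable_def)
  obtain g0 where g0 [measurable]: "g0 \<in> borel_measurable borel" and ae0: "AE u in lebesgue. G u = g0 u"
    using ex_borel_representative borel_measurable_integrable[OF G] by blast
  define g where "g = (\<lambda>u. indicator {0<..} u *\<^sub>R g0 u)"
  have gm [measurable]: "g \<in> borel_measurable borel" unfolding g_def by measurable
  have gm': "g \<in> borel_measurable lebesgue" by (rule measurable_completion) simp
  have ae: "AE u in lebesgue. G u = g u"
    using ae0 by eventually_elim (auto simp: g_def G_def indicator_def)
  have "integrable lebesgue g" by (rule integrable_cong_AE_imp[OF G gm' ae])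
  hence g: "integrable lborel g" by (subst (asm) integrable_completion) auto
  have "(LINT u|lborel. g u * iexp (t * ln u)) = c" for t
  proof -
    have "(LINT u|lborel. g u * iexp (t * ln u)) = (LINT u|lebesgue. g u * iexp (t * ln u))"
      by (rule integral_completion[symmetric]) measurable
    also have "\<dots> = (LINT u|lebesgue. G u * iexp (t * ln u))"
    proof (rule integral_cong_AE)
      have e: "(\<lambda>u. iexp (t * ln u)) \<in> borel_measurable lebesgue"
        by (rule measurable_completion) measurable
      show "(\<lambda>u. g u * iexp (t * ln u)) \<in> borel_measurable lebesgue"
        by (rule borel_measurable_times[OF gm' e])
      show "(\<lambda>u. G u * iexp (t * ln u)) \<in> borel_measurable lebesgue"
        by (rule borel_measurable_times[OF borel_measurable_integrable[OF G] e])
    qed (use ae in \<open>eventually_elim, simp\<close>)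
    also have "\<dots> = mellin D (Complex (1/2) t)"
      unfolding mellin_def set_lebesgue_integral_def
    proof (rule Bochner_Integration.integral_cong[OF refl])
      fix u :: real
      show "G u * iexp (t * ln u) = indicator {0<..} u *\<^sub>R (D u * of_real u powr (Complex (1/2) t - 1))"
      proof (cases "u > 0")
        case True
        have c: "Complex (1/2) t - 1 = of_real (-1/2) + \<i> * of_real t" by (simp add: complex_eq_iff)
        have "(of_real u :: complex) powr (of_real (-1/2) + \<i> * of_real t) =
            of_real u powr (of_real (-1/2)) * of_real u powr (\<i> * of_real t)" by (rule powr_add)
        also have "(of_real u :: complex) powr (of_real (-1/2)) = of_real (u powr (-1/2))"
          using True by (intro powr_of_real) auto
        also have "(of_real u :: complex) powr (\<i> * of_real t) = iexp (t * ln u)"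
          using True by (simp add: powr_def Ln_of_real mult_ac)
        finally show ?thesis using True unfolding c by (simp add: G_def)
      qed (simp add: G_def)
    qed
    also have "\<dots> = c" by (rule const) simp
    finally show ?thesis .
  qed
  note * = log_fourier_constant[OF g _ this]
  show "c = 0" by (rule *) (simp add: g_def)
  have "AE u in lborel. g u = 0" by (rule *) (simp add: g_def)
  hence "AE u in lebesgue. g u = 0" by (rule AE_completion)
  with ae show "AE u in lebesgue. 0 < u \<longrightarrow> D u = 0"
    by eventually_elim (auto simp: G_def)
qed

section \<open>The correspondence between functions and kernels\<close>

lemma mellin_weight_integrable:
  assumes "hausdorff_kernel K"
  shows "set_integrable lebesgue {0<..} (\<lambda>u. K u * of_real (u powr (-1/2)))"
proof -
  have "set_integrable lebesgue {0<..} (\<lambda>u. K u * of_real (\<bar>u\<bar> powr (-1/2)))"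
    using assms unfolding set_integrable_def hausdorff_kernel_def by (intro integrable_mult_indicator) auto
  also have "?this \<longleftrightarrow> ?thesis" by (rule set_integrable_cong) auto
  finally show ?thesis .
qed

lemma mellin_integrable:
  assumes "hausdorff_kernel K" "Re z = 1/2"
  shows "set_integrable lebesgue {0<..} (\<lambda>u. K u * of_real u powr (z - 1))"
  unfolding set_integrable_def
proof (rule Bochner_Integration.integrable_bound)
  show "integrable lebesgue (\<lambda>u. K u * of_real (\<bar>u\<bar> powr (-1/2)))"
    using assms(1) by (simp add: hausdorff_kernel_def)
  have "(\<lambda>u::real. complex_of_real u powr (z - 1)) \<in> borel_measurable lebesgue"
    by (rule borel_imp_lebesgue) measurable
  moreover have "K \<in> borel_measurable lebesgue" using assms(1) by (simp add: hausdorff_kernel_def)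
  moreover have "indicat_real {0::real<..} \<in> borel_measurable lebesgue"
    by (rule borel_imp_lebesgue[OF borel_measurable_indicator]) simp
  ultimately show "(\<lambda>u. indicat_real {0<..} u *\<^sub>R (K u * of_real u powr (z - 1))) \<in> borel_measurable lebesgue"
    by (intro borel_measurable_scaleR borel_measurable_times)
  have "Re (z - 1) = -1/2" using assms(2) by simp
  thus "AE u in lebesgue. norm (indicat_real {0<..} u *\<^sub>R (K u * of_real u powr (z - 1))) \<le>
      norm (K u * of_real (\<bar>u\<bar> powr (-1/2)))"
    by (intro AE_I2) (auto simp: indicator_def norm_mult norm_powr_real_powr simp del: minus_complex.simps)
qed

lemma mellin_diff:
  assumes "hausdorff_kernel K" "hausdorff_kernel L" "Re z = 1/2"
  shows "mellin (\<lambda>u. K u - L u) z = mellin K z - mellin L z"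
  using set_integral_diff(2)[OF mellin_integrable[OF assms(1,3)] mellin_integrable[OF assms(2,3)]]
  by (simp add: mellin_def left_diff_distrib)

theorem theorem24:
  fixes F :: "complex \<Rightarrow> complex" and U :: "complex set"
  assumes "open U" and "cball 1 1 \<subseteq> U" and "F holomorphic_on U"
  shows "(F 0 = 0 \<longrightarrow>
            (\<exists>K. K \<in> borel_measurable lebesgue \<and>
                 holomorphic_calculus U F (compression cesaro) = compression (hausdorff K) \<and>
                 (AE u in lebesgue. u < 0 \<longrightarrow> K u = 0) \<and>
                 set_integrable lebesgue {0<..} (\<lambda>u. K u * of_real (u powr (-1/2))) \<and>
                 (\<forall>z. Re z = 1/2 \<longrightarrow> mellin K z = F (inverse z)))) \<and>
         (\<forall>K. K \<in> borel_measurable lebesgue \<longrightarrow>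
              (AE u in lebesgue. u < 0 \<longrightarrow> K u = 0) \<longrightarrow>
              set_integrable lebesgue {0<..} (\<lambda>u. K u * of_real (u powr (-1/2))) \<longrightarrow>
              (\<forall>z. Re z = 1/2 \<longrightarrow> mellin K z = F (inverse z)) \<longrightarrow>
              F 0 = 0 \<and>
              compression (hausdorff K) = holomorphic_calculus U F (compression cesaro))"
proof -
  obtain K where K: "hausdorff_kernel K" and supp: "\<And>u. u \<notin> {0<..<1} \<Longrightarrow> K u = 0"
    and calc: "holomorphic_calculus U F (compression cesaro) = scalar_op (F 0) + unit_hausdorff K"
    and mellin: "\<And>s. Re s = 1/2 \<Longrightarrow> mellin K s = F (inverse s) - F 0"
    by (rule cesaro_calculus[OF assms]) blast
  have s0: "scalar_op 0 = 0" by (rule linear_0[OF bounded_linear.linear[OF bounded_linear_scalar_op]])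
  show ?thesis
  proof (intro conjI impI allI)
    assume F0: "F 0 = 0"
    show "\<exists>K. K \<in> borel_measurable lebesgue \<and>
        holomorphic_calculus U F (compression cesaro) = compression (hausdorff K) \<and>
        (AE u in lebesgue. u < 0 \<longrightarrow> K u = 0) \<and>
        set_integrable lebesgue {0<..} (\<lambda>u. K u * of_real (u powr (-1/2))) \<and>
        (\<forall>z. Re z = 1/2 \<longrightarrow> mellin K z = F (inverse z))"
      using K supp mellin F0 mellin_weight_integrable[OF K]
      by (intro exI[of _ K] conjI)
        (auto simp: calc s0 hausdorff_kernel_def)
  next
    fix L
    assume Lm: "L \<in> borel_measurable lebesgue" and neg: "AE u in lebesgue. u < 0 \<longrightarrow> L u = 0"
      and int: "set_integrable lebesgue {0<..} (\<lambda>u. L u * of_real (u powr (-1/2)))"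
      and mellin_L: "\<forall>z. Re z = 1/2 \<longrightarrow> mellin L z = F (inverse z)"
    have L: "hausdorff_kernel L" by (rule hausdorff_kernel_half_line[OF Lm neg int])
    have D: "hausdorff_kernel (\<lambda>u. L u - K u)"
      using hausdorff_kernel_add[OF L hausdorff_kernel_cmult[OF K, of "-1"]] by simp
    have const: "mellin (\<lambda>u. L u - K u) z = F 0" if "Re z = 1/2" for z
      using that mellin_L mellin by (simp add: mellin_diff[OF L K that])
    have Dm: "(\<lambda>u. L u - K u) \<in> borel_measurable lebesgue" using D by (simp add: hausdorff_kernel_def)
    note unique = mellin_constant[OF Dm mellin_weight_integrable[OF D]]
    show F0: "F 0 = 0" by (rule unique(1)) (rule const)
    have "AE u in lebesgue. 0 < u \<longrightarrow> L u - K u = 0" by (rule unique(2)) (rule const)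
    hence "AE u in lebesgue. L u = K u"
      using neg AE_lebesgue_neq[of 0]
      by eventually_elim (use supp in \<open>force simp: not_less_iff_gr_or_eq\<close>)
    hence "hausdorff L = hausdorff K" by (rule hausdorff_kernel_cong[OF L K])
    thus "compression (hausdorff L) = holomorphic_calculus U F (compression cesaro)"
      by (simp add: calc F0 s0)
  qed
qed

end
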